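(* Let $T_L\curvearrowright\mathbb{C}^n$ be a quasi-symmetric representation. Then the discriminant hyperplane arrangement $\mathcal{H}_{disc}$ and the Halpern-Leistner--Sam hyperplane arrangement $\mathcal{H}_{HLS}$ in $L^\vee_{\mathbb{C}}=L^\vee\otimes\mathbb{C}$ satisfy $$\mathcal{H}_{disc}=\mathcal{H}_{HLS}+iz,\qquad iz=-\frac{i}{2\pi}\sum_{j}\log(|n_j|)\,\beta_j\in iL^\vee_{\mathbb{R}},$$ i.e. $\mathcal{H}_{disc}$ is the collection of hyperplanes obtained by translating every hyperplane of $\mathcal{H}_{HLS}$ by $-\frac{i}{2\pi}\sum_j\log(|n_j|)\beta_j$. Here, for each nonzero weight $\beta_j$, the integer $n_j$ is defined by $\beta_j=n_j\underline{\ell}$ with $\underline{\ell}\in L^\vee$ a primitive generator of the line in $L^\vee_{\mathbb{R}}$ containing $\beta_j$ (zero weights contribute zero to the sum).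
   Context: Setting. $T_L=L\otimes\mathbb{C}^*$ is a connected complex torus with cocharacter lattice $L$, acting linearly on $\mathbb{C}^n$ with weights $\beta_1,\dots,\beta_n\in L^\vee=\mathrm{Hom}(L,\mathbb{Z})$ (listed with multiplicity). The representation is quasi-symmetric if for every line $\ell\subset L^\vee_{\mathbb{R}}$ through the origin the sum of the weights $\beta_i$ lying on $\ell$ is zero. In particular $\sum_i\beta_i=0$. Standing assumptions and toric data. The map $Q:(\mathbb{Z}^n)^\vee\to L^\vee$, $e_i^\vee\mapsto\beta_i$, is assumed surjective. Put $M=\ker Q$, $N=M^\vee$. Dualising gives an exact sequence $0\to L\xrightarrow{Q^\vee}\mathbb{Z}^n\xrightarrow{A}N\to 0$. The vectors $\omega_i:=A(e_i)\in N$ (the rays) are assumed pairwise distinct. Since $\sum_i\beta_i=0$, all rays lie on an affine hyperplane $H=\{\langle m,-\rangle=1\}$ for some $m\in M$; let $\Delta=\sigma\cap H$, where $\sigma\subset N_{\mathbb{R}}$ is the cone generated by the rays. Faces of $\Delta$ include $\Delta$ itself. The arrangement $\mathcal{H}_{disc}$. A face $\Gamma\subset\Delta$ is a circuit if there is precisely one linear relation (up to scaling) between the rays lying in $\Gamma$. For a circuit $\Gamma$, let $L_\Gamma\subset L$ be the rank-one sublattice of integral relations among the rays $\omega_j\in\Gamma$, i.e. those $l\in L$ with $\langle l,\beta_j\rangle=0$ whenever $\omega_j\notin\Gamma$, and let $l_\Gamma$ be a generator (unique up to sign). Put $c_\Gamma=\prod_{j=1}^n\langle l_\Gamma,\beta_j\rangle^{\langle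 l_\Gamma,\beta_j\rangle}\in\mathbb{Q}^\times$ (with $0^0=1$). Let $\mathrm{Log}_{br}=\frac{\log}{2\pi i}$, with the branch of $\log$ whose arguments lie in $[0,2\pi)$. Then $\mathcal{H}_{disc}$ is the collection of all complex affine hyperplanes $$H_{\Gamma,n}=\{y\in L^\vee_{\mathbb{C}}\mid\langle l_\Gamma,y\rangle=\mathrm{Log}_{br}(c_\Gamma)+n\},$$ for $\Gamma\subset\Delta$ a face which is a circuit and $n\in\mathbb{Z}$. (For quasi-symmetric representations these hyperplanes make up the preimage of the Gelfand--Kapranov--Zelevinsky discriminant locus under the universal cover $L^\vee\otimes\mathbb{C}\to\mathrm{Hom}(L,\mathbb{C}^* )$.) The arrangement $\mathcal{H}_{HLS}$. Let $\bar{\Sigma}=\{\sum_j a_j\beta_j\mid a_j\in[-1,0]\}\subset L^\vee_{\mathbb{R}}$. For $l\in L$ put $\eta_l=\max\{\langle l,\mu\rangle\mid\mu\in\bar{\Sigma}\}$, and let $$\bar{\nabla}=\{\beta\in L^\vee_{\mathbb{R}}\mid-\tfrac{\eta_l}{2}\le\langle l,\beta\rangle\le\tfrac{\eta_l}{2}\text{ for all }l\in L\},$$ a full-dimensional polytope. For each facet $F$ of $\bar{\nabla}$ let $H_F\subset L^\vee_{\mathbb{R}}$ be its supporting affine hyperplane. Consider the real hyperplane arrangement consisting of all translates of the $H_F$ by elements of $L^\vee$. Then $\mathcal{H}_{HLS}$ is the complexification of this arrangement: the collection of complex affine hyperplanes in $L^\vee_{\mathbb{C}}$ defined by the same real affine-linear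 equations. *)

theory Defs
  imports "HOL-Analysis.Analysis"
begin

text \<open>
  Bases are chosen for the lattices: \<open>L = int ^ 'r\<close> and, via the dual basis,
  \<open>L\<^sup>\<or> = int ^ 'r\<close>, so that the scalar extensions of \<open>L\<^sup>\<or>\<close> are \<open>real ^ 'r\<close> and
  \<open>complex ^ 'r\<close>.  A representation is the family of its weights
  \<open>\<beta> :: 'n \<Rightarrow> int ^ 'r\<close>; it acts on the complex space with coordinates indexed by \<open>'n\<close>.
\<close>

text \<open>The pairing of a lattice with (a scalar extension of) its dual.\<close>

definition pairing :: "int ^ 'k \<Rightarrow> 'a::comm_ring_1 ^ 'k \<Rightarrow> 'a" where
  "pairing l y = (\<Sum>k\<in>UNIV. of_int (l $ k) * y $ k)"

definition of_int_vec :: "int ^ 'k \<Rightarrow> 'a::ring_1 ^ 'k" where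
  "of_int_vec v = (\<chi> k. of_int (v $ k))"


section \<open>Quasi-symmetric representations\<close>

definition quasi_symmetric :: "('n::finite \<Rightarrow> int ^ 'r::finite) \<Rightarrow> bool" where
  "quasi_symmetric \<beta> \<longleftrightarrow>
     (\<forall>l :: (real ^ 'r) set. subspace l \<and> dim l = 1 \<longrightarrow>
        (\<Sum>j | of_int_vec (\<beta> j) \<in> l. \<beta> j) = 0)"


section \<open>Toric data\<close>

definition weight_map :: "('n::finite \<Rightarrow> int ^ 'r::finite) \<Rightarrow> int ^ 'n \<Rightarrow> int ^ 'r" where
  "weight_map \<beta> x = (\<Sum>j\<in>UNIV. x $ j *s \<beta> j)"

definition relation_lattice :: "('n::finite \<Rightarrow> int ^ 'r::finite) \<Rightarrow> (int ^ 'n) set" where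
  "relation_lattice \<beta> = {x. weight_map \<beta> x = 0}"

definition int_basis :: "('d::finite \<Rightarrow> int ^ 'n::finite) \<Rightarrow> (int ^ 'n) set \<Rightarrow> bool" where
  "int_basis b M \<longleftrightarrow> bij_betw (\<lambda>p :: int ^ 'd. \<Sum>k\<in>UNIV. p $ k *s b k) UNIV M"

text \<open>
  Let \<open>b\<close> be a basis of \<open>M = ker Q\<close>.  In the dual basis of \<open>N = M\<^sup>\<or>\<close> the map
  \<open>A\<close>, dual to the inclusion of \<open>M\<close>, sends \<open>x\<close> to the
  values of the functional \<open>m \<mapsto> \<langle>m, x\<rangle>\<close> on the basis.  So \<open>N = int ^ 'd\<close>.
\<close>

definition ray_map :: "('d::finite \<Rightarrow> int ^ 'n::finite) \<Rightarrow> int ^ 'n \<Rightarrow> int ^ 'd" where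
  "ray_map b x = (\<chi> k. pairing (b k) x)"

definition ray :: "('d::finite \<Rightarrow> int ^ 'n::finite) \<Rightarrow> 'n \<Rightarrow> int ^ 'd" where
  "ray b i = ray_map b (axis i 1)"

definition height :: "('d::finite \<Rightarrow> int ^ 'n::finite) \<Rightarrow> int ^ 'd" where
  "height b = (SOME m. \<forall>i. pairing m (ray b i) = 1)"

definition Delta :: "('d::finite \<Rightarrow> int ^ 'n::finite) \<Rightarrow> (real ^ 'd) set" where
  "Delta b = (convex_cone hull range (\<lambda>i. of_int_vec (ray b i))) \<inter> {x. pairing (height b) x = 1}"


section \<open>The discriminant arrangement\<close>

definition ray_relations ::
    "('d::finite \<Rightarrow> int ^ 'n::finite) \<Rightarrow> (real ^ 'd) set \<Rightarrow> (real ^ 'n) set" where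
  "ray_relations b \<Gamma> =
     {c. (\<forall>j. of_int_vec (ray b j) \<notin> \<Gamma> \<longrightarrow> c $ j = 0) \<and>
         (\<Sum>j\<in>UNIV. c $ j *\<^sub>R (of_int_vec (ray b j) :: real ^ 'd)) = 0}"

definition circuit :: "('d::finite \<Rightarrow> int ^ 'n::finite) \<Rightarrow> (real ^ 'd) set \<Rightarrow> bool" where
  "circuit b \<Gamma> \<longleftrightarrow> \<Gamma> face_of Delta b \<and> dim (ray_relations b \<Gamma>) = 1"

definition circuit_lattice ::
    "('n::finite \<Rightarrow> int ^ 'r::finite) \<Rightarrow> ('d::finite \<Rightarrow> int ^ 'n) \<Rightarrow> (real ^ 'd) set \<Rightarrow> (int ^ 'r) set"
  where
  "circuit_lattice \<beta> b \<Gamma> =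
     {l. \<forall>j. of_int_vec (ray b j) \<notin> \<Gamma> \<longrightarrow> pairing l (\<beta> j) = 0}"

definition circuit_gen ::
    "('n::finite \<Rightarrow> int ^ 'r::finite) \<Rightarrow> ('d::finite \<Rightarrow> int ^ 'n) \<Rightarrow> (real ^ 'd) set \<Rightarrow> int ^ 'r"
  where
  "circuit_gen \<beta> b \<Gamma> = (SOME l. circuit_lattice \<beta> b \<Gamma> = range (\<lambda>k :: int. k *s l))"

text \<open>Note that \<open>0 powi 0 = 1\<close>.\<close>

definition circuit_coeff ::
    "('n::finite \<Rightarrow> int ^ 'r::finite) \<Rightarrow> ('d::finite \<Rightarrow> int ^ 'n) \<Rightarrow> (real ^ 'd) set \<Rightarrow> rat"
  where
  "circuit_coeff \<beta> b \<Gamma> =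
     (\<Prod>j\<in>UNIV. of_int (pairing (circuit_gen \<beta> b \<Gamma>) (\<beta> j))
                 powi pairing (circuit_gen \<beta> b \<Gamma>) (\<beta> j))"

text \<open>\<open>Arg2pi\<close> takes its values in the half-open interval from \<open>0\<close> (included) to \<open>2 * pi\<close>.\<close>

definition Log_br :: "complex \<Rightarrow> complex" where
  "Log_br z = (of_real (ln (norm z)) + \<i> * of_real (Arg2pi z)) / (2 * of_real pi * \<i>)"

definition disc_hyperplane ::
    "('n::finite \<Rightarrow> int ^ 'r::finite) \<Rightarrow> ('d::finite \<Rightarrow> int ^ 'n) \<Rightarrow> (real ^ 'd) set \<Rightarrow> int
      \<Rightarrow> (complex ^ 'r) set" where
  "disc_hyperplane \<beta> b \<Gamma> n =
     {y. pairing (circuit_gen \<beta> b \<Gamma>) y = Log_br (of_rat (circuit_coeff \<beta> b \<Gamma>)) + of_int n}"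

definition H_disc ::
    "('n::finite \<Rightarrow> int ^ 'r::finite) \<Rightarrow> ('d::finite \<Rightarrow> int ^ 'n) \<Rightarrow> (complex ^ 'r) set set"
  where
  "H_disc \<beta> b = {disc_hyperplane \<beta> b \<Gamma> n | \<Gamma> n. circuit b \<Gamma>}"


section \<open>The Halpern-Leistner--Sam arrangement\<close>

definition Sigma_bar :: "('n::finite \<Rightarrow> int ^ 'r::finite) \<Rightarrow> (real ^ 'r) set" where
  "Sigma_bar \<beta> = {\<Sum>j\<in>UNIV. a j *\<^sub>R of_int_vec (\<beta> j) | a. \<forall>j. a j \<in> {-1..0}}"

text \<open>The supremum is a maximum, since \<open>Sigma_bar \<beta>\<close> is compact and nonempty.\<close>

definition eta :: "('n::finite \<Rightarrow> int ^ 'r::finite) \<Rightarrow> int ^ 'r \<Rightarrow> real" where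
  "eta \<beta> l = (SUP \<mu>\<in>Sigma_bar \<beta>. pairing l \<mu>)"

definition nabla_bar :: "('n::finite \<Rightarrow> int ^ 'r::finite) \<Rightarrow> (real ^ 'r) set" where
  "nabla_bar \<beta> = {x. \<forall>l. - (eta \<beta> l / 2) \<le> pairing l x \<and> pairing l x \<le> eta \<beta> l / 2}"

text \<open>As \<open>nabla_bar \<beta>\<close> is full-dimensional, the hyperplane supporting a facet is its affine hull.\<close>

definition real_HLS :: "('n::finite \<Rightarrow> int ^ 'r::finite) \<Rightarrow> (real ^ 'r) set set" where
  "real_HLS \<beta> =
     {(\<lambda>x. x + of_int_vec t) ` (affine hull F) | F (t :: int ^ 'r). F facet_of nabla_bar \<beta>}"

definition complexification :: "(real ^ 'r::finite) set set \<Rightarrow> (complex ^ 'r) set set" where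
  "complexification \<A> =
     {{y. (\<Sum>k\<in>UNIV. of_real (a $ k) * y $ k) = of_real c} | a c.
        a \<noteq> 0 \<and> {x. (\<Sum>k\<in>UNIV. a $ k * x $ k) = c} \<in> \<A>}"

definition H_HLS :: "('n::finite \<Rightarrow> int ^ 'r::finite) \<Rightarrow> (complex ^ 'r) set set" where
  "H_HLS \<beta> = complexification (real_HLS \<beta>)"


section \<open>The translation vector\<close>

definition primitive_vec :: "int ^ 'r \<Rightarrow> bool" where
  "primitive_vec v \<longleftrightarrow> v \<noteq> 0 \<and> (\<forall>k w. v = k *s w \<longrightarrow> \<bar>k\<bar> = 1)"

text \<open>
  For \<open>\<beta> \<noteq> 0\<close> the integer is determined up to sign, which does not affect the translation vector.
\<close>

definition weight_mult :: "int ^ 'r \<Rightarrow> int" where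
  "weight_mult \<beta> = (SOME n. \<exists>v. primitive_vec v \<and> \<beta> = n *s v)"

definition shift_vec :: "('n::finite \<Rightarrow> int ^ 'r::finite) \<Rightarrow> real ^ 'r" where
  "shift_vec \<beta> =
     - (1 / (2 * pi)) *\<^sub>R
       (\<Sum>j | \<beta> j \<noteq> 0. ln \<bar>real_of_int (weight_mult (\<beta> j))\<bar> *\<^sub>R of_int_vec (\<beta> j))"

definition imag_vec :: "real ^ 'r \<Rightarrow> complex ^ 'r" where
  "imag_vec z = (\<chi> k. \<i> * of_real (z $ k))"

end

theory Submission
  imports Defs
begin

text \<open>
  Both arrangements are governed by the same primitive vectors \<open>l\<close>: those for which the weights
  orthogonal to \<open>l\<close> span a hyperplane.  By quasi-symmetry the polytope \<open>nabla_bar \<beta>\<close> is the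
  Minkowski sum of the segments from \<open>- \<beta> j / 4\<close> to \<open>\<beta> j / 4\<close>, whose facets have exactly these normals.
  On the other side, a circuit has such a vector as its generator, and conversely the weights
  orthogonal to \<open>l\<close> sum to zero, which provides the functional exposing the face that belongs to \<open>l\<close>.
  It remains to compare the constants.  The sign of \<open>circuit_coeff\<close> is that of \<open>(- 1) ^ N\<close> with
  \<open>N = eta \<beta> l\<close>, so the real part of its \<open>Log_br\<close> is \<open>eta \<beta> l / 2\<close> modulo integers.  With
  \<open>\<beta> j = n j *s v j\<close> and \<open>v j\<close> primitive, the contributions of the \<open>v j\<close> to the imaginary part cancel
  along each line, and those of the \<open>n j\<close> make up the translation vector.
\<close>

section \<open>Lattice vectors inside real space, and the pairing\<close>

abbreviation real_vec :: "int ^ 'k \<Rightarrow> real ^ 'k" where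
  "real_vec \<equiv> of_int_vec"

lemma real_vec_nth [simp]: "real_vec v $ k = of_int (v $ k)"
  by (simp add: of_int_vec_def)

lemma real_vec_eq_iff [simp]: "real_vec v = real_vec w \<longleftrightarrow> v = w"
  by (simp add: vec_eq_iff)

lemma real_vec_eq_0_iff [simp]: "real_vec v = 0 \<longleftrightarrow> v = 0"
  by (simp add: vec_eq_iff)

lemma real_vec_smult [simp]: "real_vec (k *s v) = of_int k *\<^sub>R real_vec v"
  by (simp add: vec_eq_iff)

lemma pairing_real: "pairing l x = real_vec l \<bullet> x"
  by (simp add: pairing_def inner_vec_def)

lemma inner_real_vec: "real_vec l \<bullet> real_vec v = of_int (pairing l v)"
  by (simp add: pairing_def inner_vec_def)

lemma pairing_smult_left: "pairing (k *s l) y = of_int k * pairing l y"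
  by (simp add: pairing_def sum_distrib_left mult.assoc)

lemma pairing_add: "pairing l (x + y) = pairing l x + pairing l y"
  by (simp add: pairing_def sum.distrib algebra_simps)

lemma pairing_diff: "pairing l (x - y) = pairing l x - pairing l y"
  by (simp add: pairing_def sum_subtractf algebra_simps)

lemma pairing_imag_vec: "pairing l (imag_vec z) = \<i> * of_real (pairing l z)"
  by (simp add: pairing_def imag_vec_def sum_distrib_left algebra_simps)

section \<open>Primitive vectors\<close>

text \<open>Dividing \<open>w\<close> by the gcd of its coordinates leaves a vector whose
  coordinates have no common factor.\<close>

lemma exists_primitive:
  fixes w :: "int ^ 'k::finite"
  assumes "w \<noteq> 0"
  obtains n v where "primitive_vec v" "w = n *s v" "n > 0"
proof -
  define n where "n = Gcd (range (($) w))"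
  have n0: "n \<noteq> 0"
    using assms by (auto simp: n_def Gcd_0_iff vec_eq_iff)
  then have npos: "n > 0"
    using Gcd_int_greater_eq_0[of "range (($) w)"] unfolding n_def by linarith
  have dv: "n dvd w $ k" for k
    by (auto simp: n_def)
  define v :: "int ^ 'k" where "v = (\<chi> k. w $ k div n)"
  have w: "w = n *s v"
    using dv by (simp add: v_def vec_eq_iff)
  have "\<bar>k\<bar> = 1" if "v = k *s u" for k u
  proof -
    have "n * k dvd w $ i" for i
      using w that by simp
    then have "n * k dvd n"
      unfolding n_def by (intro Gcd_greatest) auto
    then show ?thesis
      using n0 by (simp add: dvd_mult_cancel_left zdvd1_eq)
  qed
  moreover have "v \<noteq> 0"
    using w assms by (auto simp: vec_eq_iff)
  ultimately have "primitive_vec v"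
    by (simp add: primitive_vec_def)
  then show ?thesis
    using w npos that by blast
qed

text \<open>The lattice points on the line through a primitive vector are its integer multiples.
  With \<open>t = p / q\<close> in lowest terms, \<open>q\<close> divides every coordinate of
  \<open>v\<close>, so primitivity forces \<open>q = 1\<close>.\<close>

lemma primitive_real_multiple:
  fixes v w :: "int ^ 'k::finite"
  assumes v: "primitive_vec v" and w: "real_vec w = t *\<^sub>R real_vec v"
  obtains k :: int where "t = of_int k" "w = k *s v"
proof -
  have eq: "of_int (w $ i) = t * of_int (v $ i)" for i
    using w by (auto simp: vec_eq_iff)
  obtain i where i: "v $ i \<noteq> 0"
    using v by (auto simp: primitive_vec_def vec_eq_iff)
  have "t = of_int (w $ i) / of_int (v $ i)"
    using eq[of i] i by (simp add: field_simps)
  then have "t \<in> \<rat>" by simp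
  then obtain p q where pq: "q > 0" "coprime p q" "t = of_int p / of_int q"
    by (rule Rats_cases')
  have qp: "q * w $ j = p * v $ j" for j
  proof -
    have "real_of_int (q * w $ j) = of_int (p * v $ j)"
      using eq[of j] pq by (simp add: field_simps)
    then show ?thesis by linarith
  qed
  have "q dvd v $ j" for j
    using qp[of j] pq(2) by (metis coprime_commute coprime_dvd_mult_right_iff dvd_triv_left)
  then have "v = q *s (\<chi> j. v $ j div q)"
    by (simp add: vec_eq_iff)
  then have "\<bar>q\<bar> = 1"
    using v unfolding primitive_vec_def by blast
  with pq(1) have "q = 1" by simp
  then have "t = of_int p" "w = p *s v"
    using pq(3) qp by (auto simp: vec_eq_iff)
  then show ?thesis using that by blast
qed

lemma sum_bezout_int:
  fixes f :: "'a \<Rightarrow> int"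
  assumes "finite S"
  shows "\<exists>t. (\<Sum>k\<in>S. f k * t k) = Gcd (f ` S)"
  using assms
proof (induction S)
  case (insert x S)
  then obtain t where t: "(\<Sum>k\<in>S. f k * t k) = Gcd (f ` S)" by blast
  obtain u v where "u * f x + v * Gcd (f ` S) = gcd (f x) (Gcd (f ` S))"
    using bezout_int by blast
  moreover have "(\<Sum>k\<in>S. f k * (if k = x then u else v * t k)) = v * (\<Sum>k\<in>S. f k * t k)"
    unfolding sum_distrib_left using insert.hyps by (intro sum.cong) auto
  ultimately have "(\<Sum>k\<in>insert x S. f k * (if k = x then u else v * t k)) = Gcd (f ` insert x S)"
    using insert.hyps t by (simp add: algebra_simps)
  then show ?case by (intro exI)
qed simp

text \<open>The coordinates of \<open>l\<close> have gcd 1, so Bezout gives a vector of pairing 1.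
  Hence lattice translations move a hyperplane with normal \<open>l\<close> by every
  integer.\<close>

lemma primitive_pairing_surj:
  fixes l :: "int ^ 'k::finite"
  assumes "primitive_vec l"
  obtains t :: "int ^ 'k" where "pairing l t = (n::int)"
proof -
  obtain t where t: "(\<Sum>k\<in>UNIV. l $ k * t k) = Gcd (range (($) l))"
    using sum_bezout_int[of UNIV "($) l"] by auto
  have "l = Gcd (range (($) l)) *s (\<chi> k. l $ k div Gcd (range (($) l)))"
    by (simp add: vec_eq_iff)
  then have "\<bar>Gcd (range (($) l))\<bar> = 1"
    using assms unfolding primitive_vec_def by blast
  then have "(\<Sum>k\<in>UNIV. l $ k * t k) = 1"
    using t by simp
  then have "pairing l (\<chi> k. n * t k) = n"
    by (simp add: pairing_def mult.left_commute flip: sum_distrib_left)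
  then show ?thesis using that by blast
qed

section \<open>Rational hyperplanes\<close>

text \<open>The part \<open>y\<close> of \<open>a'\<close> orthogonal to \<open>a\<close> is a
  direction of the smaller hyperplane, hence orthogonal to \<open>a'\<close> as well; so
  \<open>y\<close> is orthogonal to itself and vanishes.\<close>

lemma hyperplane_subset_hyperplane:
  fixes a a' :: "'v::real_inner"
  assumes "a \<noteq> 0" and sub: "{x. a \<bullet> x = c} \<subseteq> {x. a' \<bullet> x = c'}"
  obtains t where "a' = t *\<^sub>R a" "c' = t * c"
proof -
  define t where "t = (a' \<bullet> a) / (a \<bullet> a)"
  define x where "x = (c / (a \<bullet> a)) *\<^sub>R a"
  define y where "y = a' - t *\<^sub>R a"
  have aa: "a \<bullet> a \<noteq> 0" using assms by simp
  have ax: "a \<bullet> x = c" and ay: "a \<bullet> y = 0"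
    using aa by (simp_all add: x_def y_def t_def inner_diff_right inner_commute)
  have x': "a' \<bullet> x = c'" and "a' \<bullet> (x + y) = c'"
    using subsetD[OF sub, of x] subsetD[OF sub, of "x + y"] ax ay
    by (simp_all add: inner_add_right)
  then have "a' \<bullet> y = 0" by (simp add: inner_add_right)
  then have "y \<bullet> y = 0"
    using ay by (simp add: y_def inner_diff_left)
  then have "a' = t *\<^sub>R a" by (simp add: y_def)
  moreover have "c' = t * c"
    using x' ax calculation by simp
  ultimately show ?thesis using that by blast
qed

text \<open>Stated over a general field because it serves both for a rational kernel vector and for
  a real vector with rational coordinates.\<close>

lemma common_denominator:
  fixes x :: "'a::field_char_0 ^ 'k::finite"
  assumes "\<And>k. x $ k \<in> \<rat>"
  obtains q :: int and l :: "int ^ 'k" where "q > 0" "\<And>k. of_int (l $ k) = of_int q * x $ k"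
proof -
  have "\<forall>k. \<exists>r. x $ k = of_rat r" using assms by (meson Rats_cases)
  then obtain r where r: "\<And>k. x $ k = of_rat (r k)" by metis
  define q where "q = (\<Prod>k\<in>UNIV. snd (quotient_of (r k)))"
  have "\<exists>z::int. of_int z = of_int q * x $ k" for k
  proof -
    have "snd (quotient_of (r k)) dvd q"
      unfolding q_def by (intro dvd_prodI) auto
    then obtain u where u: "q = snd (quotient_of (r k)) * u" by (elim dvdE)
    obtain m d where md: "quotient_of (r k) = (m, d)" by fastforce
    then have "r k = of_int m / of_int d" "d > 0"
      by (auto simp: quotient_of_div quotient_of_denom_pos)
    then have "of_int (m * u) = of_int q * x $ k"
      using u md by (simp add: r of_rat_divide)
    then show ?thesis by blast
  qed
  then obtain z :: "'k \<Rightarrow> int" where "\<And>k. of_int (z k) = of_int q * x $ k" by metis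
  moreover have "q > 0"
    by (auto simp: q_def quotient_of_denom_pos' intro!: prod_pos)
  ultimately show ?thesis using that[of q "\<chi> k. z k"] by simp
qed

text \<open>A rational matrix without rational kernel has a rational left inverse, hence no real kernel.\<close>

lemma exists_integer_orthogonal:
  fixes \<beta> :: "'n::finite \<Rightarrow> int ^ 'r::finite" and a :: "real ^ 'r"
  assumes "a \<noteq> 0" and orth: "\<And>j. j \<in> J \<Longrightarrow> a \<bullet> real_vec (\<beta> j) = 0"
  obtains l where "l \<noteq> 0" "\<And>j. j \<in> J \<Longrightarrow> pairing l (\<beta> j) = 0"
proof -
  define A :: "rat ^ 'r ^ 'n" where "A = (\<chi> j k. if j \<in> J then of_int (\<beta> j $ k) else 0)"
  have "\<exists>x. A *v x = 0 \<and> x \<noteq> 0"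
  proof (rule ccontr)
    assume "\<not> ?thesis"
    then have "\<forall>x. A *v x = 0 \<longrightarrow> x = 0" by simp
    then obtain B :: "rat ^ 'n ^ 'r" where B: "B ** A = mat 1"
      unfolding matrix_left_invertible_ker[symmetric] by (elim exE)
    have "a $ i = 0" for i
    proof -
      have e: "real_of_rat (if i = k then 1 else 0) =
          (\<Sum>j\<in>UNIV. of_rat (B $ i $ j) * (if j \<in> J then of_int (\<beta> j $ k) else 0))" for k
      proof -
        have "(if i = k then 1 else 0) = (B ** A) $ i $ k"
          by (simp add: B mat_def)
        then have "(if i = k then 1 else 0) = (\<Sum>j\<in>UNIV. B $ i $ j * A $ j $ k)"
          by (simp add: matrix_matrix_mult_def)
        then have "real_of_rat (if i = k then 1 else 0) = of_rat (\<Sum>j\<in>UNIV. B $ i $ j * A $ j $ k)"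
          by (rule arg_cong)
        then show ?thesis
          by (simp add: A_def of_rat_sum of_rat_mult if_distrib[of of_rat] cong: if_cong)
      qed
      have "a $ i = (\<Sum>k\<in>UNIV. (if i = k then 1 else 0) * a $ k)"
        by (simp add: if_distrib[of "\<lambda>x. x * _"] cong: if_cong)
      also have "\<dots> = (\<Sum>k\<in>UNIV. real_of_rat (if i = k then 1 else 0) * a $ k)"
        by (intro sum.cong) auto
      also have "\<dots> = (\<Sum>k\<in>UNIV. \<Sum>j\<in>UNIV.
          of_rat (B $ i $ j) * (if j \<in> J then of_int (\<beta> j $ k) else 0) * a $ k)"
        unfolding e by (simp add: sum_distrib_right)
      also have "\<dots> = (\<Sum>j\<in>UNIV. \<Sum>k\<in>UNIV.
          of_rat (B $ i $ j) * (if j \<in> J then of_int (\<beta> j $ k) else 0) * a $ k)"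
        by (rule sum.swap)
      also have "\<dots> = (\<Sum>j\<in>UNIV. of_rat (B $ i $ j) * (if j \<in> J then a \<bullet> real_vec (\<beta> j) else 0))"
        by (intro sum.cong refl) (auto simp: inner_vec_def sum_distrib_left mult_ac)
      also have "\<dots> = 0"
        by (intro sum.neutral) (auto simp: orth)
      finally show ?thesis .
    qed
    then show False using \<open>a \<noteq> 0\<close> by (simp add: vec_eq_iff)
  qed
  then obtain x where x: "A *v x = 0" "x \<noteq> 0" by blast
  have "x $ k \<in> \<rat>" for k
    using Rats_of_rat[of "x $ k", where ?'a = rat] by simp
  then obtain q and l :: "int ^ 'r" where q: "q > 0" and l: "\<And>k. of_int (l $ k) = of_int q * x $ k"
    by (rule common_denominator) blast
  have "l \<noteq> 0"
  proof
    assume "l = 0"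
    then have "x $ k = 0" for k using l[of k] q by simp
    then show False using x(2) by (simp add: vec_eq_iff)
  qed
  moreover have "pairing l (\<beta> j) = 0" if "j \<in> J" for j
  proof -
    have "(A *v x) $ j = (\<Sum>k\<in>UNIV. of_int (\<beta> j $ k) * x $ k)"
      using that by (simp add: A_def matrix_vector_mult_def)
    then have "(\<Sum>k\<in>UNIV. of_int (\<beta> j $ k) * x $ k) = 0"
      using x(1) by simp
    then have "of_int q * (\<Sum>k\<in>UNIV. of_int (\<beta> j $ k) * x $ k) = 0" by simp
    then have "(of_int (pairing l (\<beta> j)) :: rat) = 0"
      by (simp add: pairing_def l sum_distrib_left mult_ac)
    then show ?thesis by simp
  qed
  ultimately show ?thesis using that by blast
qed

section \<open>Quasi-symmetric families of weights\<close>

text \<open>A coefficient that is constant along each line factors out of that line's sum, which is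
  zero by quasi-symmetry. The later uses take for \<open>g\<close> the constant 1, the indicator of
  orthogonality to \<open>l\<close>, and a logarithm.\<close>

lemma quasi_symmetric_weighted_sum:
  fixes \<beta> :: "'n::finite \<Rightarrow> int ^ 'r::finite" and g :: "'n \<Rightarrow> real"
  assumes qs: "quasi_symmetric \<beta>"
    and g: "\<And>i j c. \<lbrakk>\<beta> i \<noteq> 0; \<beta> j \<noteq> 0; real_vec (\<beta> j) = c *\<^sub>R real_vec (\<beta> i)\<rbrakk> \<Longrightarrow> g i = g j"
  shows "(\<Sum>j\<in>UNIV. g j *\<^sub>R real_vec (\<beta> j)) = 0"
proof -
  define S where "S = {j. \<beta> j \<noteq> 0}"
  define f where "f j = span {real_vec (\<beta> j)}" for j
  have "(\<Sum>j\<in>{j \<in> S. f j = f i}. g j *\<^sub>R real_vec (\<beta> j)) = 0" if i: "i \<in> S" for i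
  proof -
    have "dim (f i) = 1"
      using i by (simp add: f_def S_def)
    then have "(\<Sum>j | real_vec (\<beta> j) \<in> f i. \<beta> j) = 0"
      using qs by (auto simp: quasi_symmetric_def f_def)
    then have "real_vec (\<Sum>j | real_vec (\<beta> j) \<in> f i. \<beta> j) = 0"
      by simp
    then have 1: "(\<Sum>j | real_vec (\<beta> j) \<in> f i. real_vec (\<beta> j)) = 0"
      by (simp add: vec_eq_iff)
    have "g j = g i" "real_vec (\<beta> j) \<in> f i" if j: "j \<in> S" "f j = f i" for j
    proof -
      have "real_vec (\<beta> j) \<in> f j" by (simp add: f_def span_base)
      then show "real_vec (\<beta> j) \<in> f i" using j by simp
      then obtain c where "real_vec (\<beta> j) = c *\<^sub>R real_vec (\<beta> i)"
        by (auto simp: f_def span_singleton)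
      then show "g j = g i" using g[of i j c] i j(1) by (simp add: S_def)
    qed
    moreover have "f j = f i" if j: "j \<in> S" "real_vec (\<beta> j) \<in> f i" for j
    proof -
      obtain c where c: "real_vec (\<beta> j) = c *\<^sub>R real_vec (\<beta> i)"
        using j by (auto simp: f_def span_singleton)
      moreover have "c \<noteq> 0" using c j(1) by (auto simp: S_def)
      ultimately have "real_vec (\<beta> i) = (1 / c) *\<^sub>R real_vec (\<beta> j)" by simp
      then have "real_vec (\<beta> i) \<in> f j" unfolding f_def span_singleton by blast
      then have "f i \<subseteq> f j" unfolding f_def by (intro span_minimal) auto
      moreover have "f j \<subseteq> f i" using j(2) unfolding f_def by (intro span_minimal) auto
      ultimately show ?thesis by blast
    qed
    \<comment> \<open>The index set on the right also contains the zero weights, which add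
      nothing.\<close>
    ultimately have "(\<Sum>j\<in>{j \<in> S. f j = f i}. g j *\<^sub>R real_vec (\<beta> j)) =
        (\<Sum>j\<in>{j. real_vec (\<beta> j) \<in> f i}. g i *\<^sub>R real_vec (\<beta> j))"
      by (intro sum.mono_neutral_cong_left) (auto simp: S_def)
    also have "\<dots> = 0"
      using 1 by (simp flip: scaleR_sum_right)
    finally show ?thesis .
  qed
  then have "(\<Sum>y\<in>f ` S. \<Sum>j\<in>{j \<in> S. f j = y}. g j *\<^sub>R real_vec (\<beta> j)) = 0"
    by (intro sum.neutral) auto
  then have "(\<Sum>j\<in>S. g j *\<^sub>R real_vec (\<beta> j)) = 0"
    by (simp add: sum.group)
  moreover have "(\<Sum>j\<in>UNIV. g j *\<^sub>R real_vec (\<beta> j)) = (\<Sum>j\<in>S. g j *\<^sub>R real_vec (\<beta> j))"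
    by (intro sum.mono_neutral_right) (auto simp: S_def)
  ultimately show ?thesis by simp
qed

lemma quasi_symmetric_sum_orthogonal:
  fixes \<beta> :: "'n::finite \<Rightarrow> int ^ 'r::finite"
  assumes "quasi_symmetric \<beta>"
  shows "(\<Sum>j\<in>UNIV. of_bool (pairing l (\<beta> j) = (0::int)) *s \<beta> j) = 0"
proof -
  have iff: "(pairing l (\<beta> i) = (0::int)) \<longleftrightarrow> (pairing l (\<beta> j) = (0::int))"
    if "\<beta> i \<noteq> 0" "\<beta> j \<noteq> 0" "real_vec (\<beta> j) = c *\<^sub>R real_vec (\<beta> i)" for i j c
  proof -
    have "real_of_int (pairing l (\<beta> j)) = c * of_int (pairing l (\<beta> i))"
      using that(3) by (simp flip: inner_real_vec)
    moreover have "c \<noteq> 0" using that by auto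
    ultimately show ?thesis by auto
  qed
  have "(\<Sum>j\<in>UNIV. of_bool (pairing l (\<beta> j) = (0::int)) *\<^sub>R real_vec (\<beta> j)) = 0"
    by (intro quasi_symmetric_weighted_sum[OF assms] arg_cong[where f = of_bool]) (rule iff)
  moreover have "real_vec (\<Sum>j\<in>UNIV. of_bool (pairing l (\<beta> j) = (0::int)) *s \<beta> j) =
      (\<Sum>j\<in>UNIV. of_bool (pairing l (\<beta> j) = (0::int)) *\<^sub>R real_vec (\<beta> j))"
    by (simp add: vec_eq_iff)
  ultimately show ?thesis by simp
qed

lemma quasi_symmetric_sum_pairing:
  fixes \<beta> :: "'n::finite \<Rightarrow> int ^ 'r::finite"
  assumes "quasi_symmetric \<beta>"
  shows "(\<Sum>j\<in>UNIV. pairing l (\<beta> j)) = (0::int)"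
proof -
  have "(\<Sum>j\<in>UNIV. 1 *\<^sub>R real_vec (\<beta> j)) = 0"
    by (rule quasi_symmetric_weighted_sum[OF assms]) simp
  then have "real_vec l \<bullet> (\<Sum>j\<in>UNIV. real_vec (\<beta> j)) = 0" by simp
  then have "real_of_int (\<Sum>j\<in>UNIV. pairing l (\<beta> j)) = 0"
    by (simp add: inner_sum_right inner_real_vec)
  then show ?thesis by linarith
qed

lemma weight_mult_ex:
  assumes "w \<noteq> 0"
  obtains v :: "int ^ 'k::finite" where "primitive_vec v" "w = weight_mult w *s v" "weight_mult w \<noteq> 0"
proof -
  have "\<exists>n v. primitive_vec v \<and> w = n *s v"
    using exists_primitive[OF assms] by metis
  then have "\<exists>v. primitive_vec v \<and> w = weight_mult w *s v"
    unfolding weight_mult_def by (rule someI_ex)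
  then obtain v where v: "primitive_vec v" "w = weight_mult w *s v" by blast
  moreover have "weight_mult w \<noteq> 0"
  proof
    assume "weight_mult w = 0"
    then have "w = 0" using v(2) by (simp add: vec_eq_iff)
    then show False using assms by simp
  qed
  ultimately show ?thesis using that by blast
qed

text \<open>If \<open>\<beta> j = n j *s v j\<close> with \<open>v j\<close> primitive, then \<open>\<bar>pairing l (v j)\<bar>\<close> is constant along each line, so
  by quasi-symmetry its logarithm does not contribute to the weighted sum.\<close>

lemma quasi_symmetric_entropy:
  fixes \<beta> :: "'n::finite \<Rightarrow> int ^ 'r::finite"
  assumes "quasi_symmetric \<beta>"
  shows "(\<Sum>j\<in>UNIV. of_int (pairing l (\<beta> j)) * ln \<bar>real_of_int (pairing l (\<beta> j))\<bar>) =
         - (2 * pi) * pairing l (shift_vec \<beta>)"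
proof -
  define v where "v j = (SOME v. primitive_vec v \<and> \<beta> j = weight_mult (\<beta> j) *s v)" for j
  have v: "primitive_vec (v j)" "\<beta> j = weight_mult (\<beta> j) *s v j" "weight_mult (\<beta> j) \<noteq> 0"
    if nz: "\<beta> j \<noteq> 0" for j
  proof -
    obtain u where "primitive_vec u" "\<beta> j = weight_mult (\<beta> j) *s u" "weight_mult (\<beta> j) \<noteq> 0"
      using weight_mult_ex[OF nz] by metis
    then show "primitive_vec (v j)" "\<beta> j = weight_mult (\<beta> j) *s v j" "weight_mult (\<beta> j) \<noteq> 0"
      using someI[of "\<lambda>v. primitive_vec v \<and> \<beta> j = weight_mult (\<beta> j) *s v" u]
      by (auto simp: v_def)
  qed
  define g where "g j = ln \<bar>real_of_int (pairing l (v j))\<bar>" for j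
  have "g i = g j" if nz: "\<beta> i \<noteq> 0" "\<beta> j \<noteq> 0" and c: "real_vec (\<beta> j) = c *\<^sub>R real_vec (\<beta> i)" for i j c
  proof -
    \<comment> \<open>Primitive vectors on the same line agree up to sign, so \<open>g\<close>,
      built from an absolute value, is constant along lines.\<close>
    have "real_vec (weight_mult (\<beta> j) *s v j) = c *\<^sub>R real_vec (weight_mult (\<beta> i) *s v i)"
      using v(2)[OF nz(1)] v(2)[OF nz(2)] c by simp
    then have "of_int (weight_mult (\<beta> j)) *\<^sub>R real_vec (v j) =
        (c * of_int (weight_mult (\<beta> i))) *\<^sub>R real_vec (v i)"
      by simp
    then have "real_vec (v j) = (c * of_int (weight_mult (\<beta> i)) / of_int (weight_mult (\<beta> j))) *\<^sub>R real_vec (v i)"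
      using v(3)[OF nz(2)] by (metis (no_types, lifting) divide_inverse_commute of_int_eq_0_iff
          scaleR_cancel_left scaleR_scaleR nonzero_mult_div_cancel_left times_divide_eq_right)
    then obtain k where "v j = k *s v i"
      using primitive_real_multiple[OF v(1)[OF nz(1)]] by metis
    moreover have "\<bar>k\<bar> = 1"
      using v(1)[OF nz(2)] calculation unfolding primitive_vec_def by blast
    then have "\<bar>real_of_int k\<bar> = 1" by linarith
    ultimately have "\<bar>real_of_int (pairing l (v j))\<bar> = \<bar>real_of_int (pairing l (v i))\<bar>"
      by (simp add: abs_mult flip: inner_real_vec)
    then show ?thesis by (simp add: g_def)
  qed
  then have "(\<Sum>j\<in>UNIV. g j *\<^sub>R real_vec (\<beta> j)) = 0"
    by (rule quasi_symmetric_weighted_sum[OF assms])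
  then have "real_vec l \<bullet> (\<Sum>j\<in>UNIV. g j *\<^sub>R real_vec (\<beta> j)) = 0" by simp
  then have g0: "(\<Sum>j\<in>UNIV. g j * of_int (pairing l (\<beta> j))) = 0"
    by (simp add: inner_sum_right inner_real_vec)
  \<comment> \<open>The logarithm of a product splits into the part of \<open>v j\<close>, which
    cancels by \<open>g0\<close>, and the part of \<open>weight_mult (\<beta> j)\<close>. If the
    pairing is zero, both sides vanish whatever the logarithms are.\<close>
  have "of_int (pairing l (\<beta> j)) * ln \<bar>real_of_int (pairing l (\<beta> j))\<bar> =
      g j * of_int (pairing l (\<beta> j)) +
      (if \<beta> j \<noteq> 0 then ln \<bar>real_of_int (weight_mult (\<beta> j))\<bar> * of_int (pairing l (\<beta> j)) else 0)" for j
  proof (cases "pairing l (\<beta> j) = (0::int)")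
    case False
    then have nz: "\<beta> j \<noteq> 0" by (auto simp: pairing_def)
    have "real_of_int (pairing l (\<beta> j)) = of_int (weight_mult (\<beta> j)) * of_int (pairing l (v j))"
      by (subst v(2)[OF nz]) (simp flip: inner_real_vec)
    moreover from this have "pairing l (v j) \<noteq> (0::int)" using False by auto
    ultimately show ?thesis using nz v(3)[OF nz]
      by (simp add: abs_mult ln_mult g_def) (simp add: algebra_simps)
  qed simp
  then have "(\<Sum>j\<in>UNIV. of_int (pairing l (\<beta> j)) * ln \<bar>real_of_int (pairing l (\<beta> j))\<bar>) =
      (\<Sum>j | \<beta> j \<noteq> 0. ln \<bar>real_of_int (weight_mult (\<beta> j))\<bar> * of_int (pairing l (\<beta> j)))"
    by (simp add: sum.distrib g0 sum.If_cases)
  also have "\<dots> = - (2 * pi) * pairing l (shift_vec \<beta>)"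
    by (simp add: pairing_real shift_vec_def inner_sum_right inner_real_vec)
  finally show ?thesis .
qed

section \<open>Evaluation of \<open>eta\<close>\<close>

text \<open>Valued in \<open>nat\<close> because the number plays two roles: it is the value of
  \<open>eta\<close>, and its parity decides the sign of \<open>circuit_coeff\<close>.\<close>

definition neg_sum :: "('n::finite \<Rightarrow> int ^ 'r) \<Rightarrow> int ^ 'r \<Rightarrow> nat" where
  "neg_sum \<beta> l = (\<Sum>j\<in>UNIV. nat (- pairing l (\<beta> j)))"

text \<open>Each absolute value is the pairing plus twice its negative part, and the pairings
  themselves sum to zero.\<close>

lemma abs_sum_eq_neg_sum:
  fixes \<beta> :: "'n::finite \<Rightarrow> int ^ 'r::finite"
  assumes "quasi_symmetric \<beta>"
  shows "(\<Sum>j\<in>UNIV. \<bar>real_vec l \<bullet> real_vec (\<beta> j)\<bar>) = 2 * real (neg_sum \<beta> l)"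
proof -
  have "(\<Sum>j\<in>UNIV. \<bar>pairing l (\<beta> j)\<bar>) = (\<Sum>j\<in>UNIV. pairing l (\<beta> j) + 2 * int (nat (- pairing l (\<beta> j))))"
    by (intro sum.cong) auto
  also have "\<dots> = 2 * int (neg_sum \<beta> l)"
    by (simp add: sum.distrib quasi_symmetric_sum_pairing[OF assms] neg_sum_def sum_distrib_left)
  finally have "real_of_int (\<Sum>j\<in>UNIV. \<bar>pairing l (\<beta> j)\<bar>) = of_int (2 * int (neg_sum \<beta> l))"
    by (rule arg_cong)
  then show ?thesis by (simp add: inner_real_vec)
qed

text \<open>The maximum is attained by giving coefficient -1 to the weights of negative pairing and
  0 to all others.\<close>

lemma eta_eq:
  fixes \<beta> :: "'n::finite \<Rightarrow> int ^ 'r::finite"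
  shows "eta \<beta> l = real (neg_sum \<beta> l)"
  unfolding eta_def
proof (rule cSup_eq_maximum)
  have "pairing l (\<Sum>j\<in>UNIV. (- of_bool (pairing l (\<beta> j) < (0::int))) *\<^sub>R real_vec (\<beta> j)) =
      (\<Sum>j\<in>UNIV. - of_bool (pairing l (\<beta> j) < (0::int)) * real_of_int (pairing l (\<beta> j)))"
    by (simp only: pairing_real inner_sum_right inner_scaleR_right inner_real_vec)
  also have "\<dots> = (\<Sum>j\<in>UNIV. real (nat (- pairing l (\<beta> j))))"
    by (intro sum.cong) auto
  finally show "real (neg_sum \<beta> l) \<in> pairing l ` Sigma_bar \<beta>"
    unfolding neg_sum_def Sigma_bar_def of_nat_sum
    by (intro rev_image_eqI[of "\<Sum>j\<in>UNIV. (- of_bool (pairing l (\<beta> j) < (0::int))) *\<^sub>R real_vec (\<beta> j)"])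
      (auto intro!: exI[of _ "\<lambda>j. - of_bool (pairing l (\<beta> j) < (0::int))"])
next
  fix x assume "x \<in> pairing l ` Sigma_bar \<beta>"
  then obtain a where a: "\<And>j. a j \<in> {-1..0}" and x: "x = pairing l (\<Sum>j\<in>UNIV. a j *\<^sub>R real_vec (\<beta> j))"
    by (auto simp: Sigma_bar_def)
  have "a j * real_of_int p \<le> real (nat (- p))" for j p
  proof (cases "p \<ge> 0")
    case True
    then show ?thesis using a[of j] by (auto simp: mult_nonpos_nonneg)
  next
    case False
    then have "(a j + 1) * real_of_int p \<le> 0"
      using a[of j] by (intro mult_nonneg_nonpos) auto
    then show ?thesis using False by (simp add: algebra_simps)
  qed
  then show "x \<le> real (neg_sum \<beta> l)"
    by (auto simp: x pairing_real inner_sum_right inner_real_vec neg_sum_def intro!: sum_mono)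
qed

section \<open>Normal vectors of the arrangements\<close>

text \<open>The annihilator of the weights indexed by \<open>J\<close>. If \<open>J\<close> lists
  the rays outside a face, it is a copy of the space of relations among the rays in that
  face.\<close>

definition orthogonal_weights :: "('n::finite \<Rightarrow> int ^ 'r::finite) \<Rightarrow> 'n set \<Rightarrow> (real ^ 'r) set" where
  "orthogonal_weights \<beta> J = {a. \<forall>j\<in>J. a \<bullet> real_vec (\<beta> j) = 0}"

text \<open>The weights orthogonal to \<open>l\<close> span the hyperplane orthogonal to \<open>l\<close>.\<close>

definition arrangement_normal :: "('n::finite \<Rightarrow> int ^ 'r::finite) \<Rightarrow> int ^ 'r \<Rightarrow> bool" where
  "arrangement_normal \<beta> l \<longleftrightarrow> primitive_vec l \<and>
     orthogonal_weights \<beta> {j. pairing l (\<beta> j) = (0::int)} \<subseteq> span {real_vec l}"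

lemma real_vec_in_orthogonal_weights:
  "real_vec l \<in> orthogonal_weights \<beta> J \<longleftrightarrow> (\<forall>j\<in>J. pairing l (\<beta> j) = (0::int))"
  by (simp add: orthogonal_weights_def inner_real_vec)

lemma subspace_orthogonal_weights: "subspace (orthogonal_weights \<beta> J)"
  by (auto simp: orthogonal_weights_def subspace_def inner_add_left)

lemma arrangement_normal_iff:
  "arrangement_normal \<beta> l \<longleftrightarrow> primitive_vec l \<and>
     orthogonal_weights \<beta> {j. pairing l (\<beta> j) = (0::int)} = span {real_vec l}"
proof -
  have "span {real_vec l} \<subseteq> orthogonal_weights \<beta> {j. pairing l (\<beta> j) = (0::int)}"
    by (intro span_minimal subspace_orthogonal_weights) (simp add: real_vec_in_orthogonal_weights)
  then show ?thesis by (auto simp: arrangement_normal_def)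
qed

lemma primitive_vec_uminus [simp]: "primitive_vec (- v) \<longleftrightarrow> primitive_vec v"
proof -
  have "primitive_vec (- v)" if v: "primitive_vec v" for v :: "int ^ 'k"
    unfolding primitive_vec_def
  proof (intro conjI allI impI)
    show "- v \<noteq> 0" using v by (simp add: primitive_vec_def)
    fix k w assume "- v = k *s w"
    then have "v = - (k *s w)" by (metis minus_minus)
    then have "v = k *s (- w)" by (simp add: vec_eq_iff)
    then show "\<bar>k\<bar> = 1" using v unfolding primitive_vec_def by blast
  qed
  from this[of v] this[of "- v"] show ?thesis by auto
qed

lemma pairing_uminus_left: "pairing (- l) y = - pairing l y"
  by (simp add: pairing_def sum_negf)

lemma real_vec_uminus: "real_vec (- l) = - real_vec l"
  by (simp add: vec_eq_iff)

lemma arrangement_normal_uminus [simp]: "arrangement_normal \<beta> (- l) \<longleftrightarrow> arrangement_normal \<beta> l"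
proof -
  have "span {- real_vec l} = span {real_vec l}"
    using span_neg[OF span_base[of "real_vec l" "{real_vec l}"]]
      span_neg[OF span_base[of "- real_vec l" "{- real_vec l}"]]
    by (intro antisym span_minimal) auto
  then show ?thesis
    by (simp add: arrangement_normal_def pairing_uminus_left real_vec_uminus)
qed

text \<open>The annihilator is cut out by integer equations, so a line of solutions contains a
  nonzero integer vector. The sign of \<open>l\<close> is chosen to make \<open>t\<close> positive,
  which lets support functions be rescaled.\<close>

lemma exists_primitive_multiple:
  fixes \<beta> :: "'n::finite \<Rightarrow> int ^ 'r::finite" and a :: "real ^ 'r"
  assumes "a \<noteq> 0" and a: "orthogonal_weights \<beta> J = span {a}"
  obtains l t where "primitive_vec l" "real_vec l = t *\<^sub>R a" "t > 0"
proof -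
  have "a \<in> orthogonal_weights \<beta> J" by (simp add: a span_base)
  then obtain l where l: "l \<noteq> 0" "\<And>j. j \<in> J \<Longrightarrow> pairing l (\<beta> j) = 0"
    using exists_integer_orthogonal[OF \<open>a \<noteq> 0\<close>, of J \<beta>]
    unfolding orthogonal_weights_def by auto
  obtain n v where v: "primitive_vec v" "l = n *s v" "n > 0"
    using exists_primitive[OF l(1)] by metis
  have "pairing v (\<beta> j) = (0::int)" if "j \<in> J" for j
    using l(2)[OF that] v by (simp add: pairing_smult_left)
  then have "real_vec v \<in> span {a}"
    unfolding a[symmetric] by (simp add: real_vec_in_orthogonal_weights)
  then obtain t where t: "real_vec v = t *\<^sub>R a"
    by (auto simp: span_singleton)
  have "real_vec v \<noteq> 0" using v(1) by (simp add: primitive_vec_def)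
  then have "t \<noteq> 0" using t by auto
  then consider "t > 0" | "- t > 0" by linarith
  then show ?thesis
  proof cases
    case 2
    have "real_vec (- v) = (- t) *\<^sub>R a" using t by (simp add: real_vec_uminus)
    then show ?thesis using that[of "- v" "- t"] v(1) 2 by simp
  qed (use that[of v t] v(1) t in simp)
qed

lemma span_scaleR_singleton: "t \<noteq> 0 \<Longrightarrow> span {t *\<^sub>R a} = span {a :: 'v::real_vector}"
  using span_scale[OF span_base[of "t *\<^sub>R a" "{t *\<^sub>R a}"], of "1 / t"]
    span_scale[OF span_base[of a "{a}"], of t]
  by (intro antisym span_minimal) auto

section \<open>Circuits\<close>

lemma ray_nth: "ray b j $ k = b k $ j"
  by (simp add: ray_def ray_map_def pairing_def axis_def if_distrib[of "\<lambda>x. _ * x"] cong: if_cong)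

text \<open>Elements of \<open>relation_lattice \<beta>\<close> act as integral functionals on the
  lattice of the rays; \<open>p\<close> is the coordinate vector of \<open>x\<close> in the basis
  \<open>b\<close>.\<close>

lemma relation_functional:
  fixes b :: "'d::finite \<Rightarrow> int ^ 'n::finite"
  assumes basis: "int_basis b (relation_lattice \<beta>)" and x: "x \<in> relation_lattice \<beta>"
  obtains p :: "int ^ 'd" where "\<And>j. pairing p (ray b j) = x $ j"
proof -
  obtain p where "x = (\<Sum>k\<in>UNIV. p $ k *s b k)"
    using basis x unfolding int_basis_def bij_betw_def by auto
  then have "pairing p (ray b j) = x $ j" for j
    by (simp add: pairing_def ray_nth)
  then show ?thesis using that by blast
qed

lemma basis_in_lattice:
  assumes "int_basis b (relation_lattice \<beta>)"
  shows "b k \<in> relation_lattice \<beta>"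
proof -
  have "(\<Sum>i\<in>UNIV. axis k 1 $ i *s b i) \<in> relation_lattice \<beta>"
    using assms unfolding int_basis_def bij_betw_def by blast
  moreover have "(\<Sum>i\<in>UNIV. axis k 1 $ i *s b i) = b k"
    by (simp add: vec_eq_iff axis_def if_distrib[of "\<lambda>x. x * _"] cong: if_cong)
  ultimately show ?thesis by simp
qed

text \<open>By surjectivity every standard basis vector is an integer combination of
  weights.\<close>

lemma orthogonal_all_weights:
  fixes \<beta> :: "'n::finite \<Rightarrow> int ^ 'r::finite"
  assumes surj: "surj (weight_map \<beta>)"
  shows "orthogonal_weights \<beta> UNIV = {0}"
proof -
  have "a = 0" if a: "\<And>j. a \<bullet> real_vec (\<beta> j) = 0" for a :: "real ^ 'r"
  proof -
    have "a $ k = 0" for k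
    proof -
      obtain x where "weight_map \<beta> x = axis k 1"
        using surj by (metis surj_def)
      then have "real_vec (axis k 1) = (\<Sum>j\<in>UNIV. of_int (x $ j) *\<^sub>R real_vec (\<beta> j))"
        by (simp add: vec_eq_iff weight_map_def flip: of_int_mult of_int_sum)
      then have "a \<bullet> real_vec (axis k 1) = 0"
        by (simp add: inner_sum_right a)
      then show ?thesis
        by (simp add: inner_vec_def axis_def if_distrib[of "\<lambda>x. _ * x"] if_distrib[of of_int] cong: if_cong)
    qed
    then show ?thesis by (simp add: vec_eq_iff)
  qed
  then show ?thesis by (auto simp: orthogonal_weights_def)
qed

text \<open>Real relations among the rays are the vectors orthogonal to \<open>relation_lattice \<beta>\<close>.  With
  \<open>s k\<close> a preimage of the \<open>k\<close>-th basis vector under \<open>weight_map \<beta>\<close>, the differences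
  \<open>axis j 1 - (\<Sum>k. \<beta> j $ k *s s k)\<close> belong to this lattice, so such a vector \<open>c\<close> is determined
  by its pairings with the \<open>s k\<close>.\<close>

lemma ray_relations_eq:
  fixes \<beta> :: "'n::finite \<Rightarrow> int ^ 'r::finite" and b :: "'d::finite \<Rightarrow> int ^ 'n"
  assumes surj: "surj (weight_map \<beta>)" and basis: "int_basis b (relation_lattice \<beta>)"
  shows "ray_relations b \<Gamma> =
    (\<lambda>a. \<chi> j. a \<bullet> real_vec (\<beta> j)) ` orthogonal_weights \<beta> {j. real_vec (ray b j) \<notin> \<Gamma>}"
proof -
  have orth_iff: "(\<Sum>j\<in>UNIV. c $ j *\<^sub>R real_vec (ray b j)) = 0 \<longleftrightarrow> (\<forall>k. c \<bullet> real_vec (b k) = 0)"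
    for c :: "real ^ 'n"
    by (simp add: vec_eq_iff ray_nth inner_vec_def)
  have 1: "\<exists>a. c = (\<chi> j. a \<bullet> real_vec (\<beta> j))" if c: "\<And>k. c \<bullet> real_vec (b k) = 0" for c :: "real ^ 'n"
  proof -
    have c0: "c \<bullet> real_vec x = 0" if x: "x \<in> relation_lattice \<beta>" for x
    proof -
      obtain p where "x = (\<Sum>k\<in>UNIV. p $ k *s b k)"
        using basis \<open>x \<in> relation_lattice \<beta>\<close> unfolding int_basis_def bij_betw_def by auto
      then have "real_vec x = (\<Sum>k\<in>UNIV. of_int (p $ k) *\<^sub>R real_vec (b k))"
        by (simp add: vec_eq_iff)
      then show ?thesis by (simp add: inner_sum_right c)
    qed
    define s where "s k = inv (weight_map \<beta>) (axis k 1)" for k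
    have s: "weight_map \<beta> (s k) = axis k 1" for k
      by (simp add: s_def surj_f_inv_f[OF surj])
    define a :: "real ^ 'r" where "a = (\<chi> k. c \<bullet> real_vec (s k))"
    have "c $ j = a \<bullet> real_vec (\<beta> j)" for j
    proof -
      define y where "y = axis j 1 - (\<Sum>k\<in>UNIV. \<beta> j $ k *s s k)"
      have "weight_map \<beta> (axis j 1) = \<beta> j"
        by (simp add: weight_map_def vec_eq_iff axis_def if_distrib[of "\<lambda>x. x * _"] cong: if_cong)
      moreover have "weight_map \<beta> (\<Sum>k\<in>UNIV. \<beta> j $ k *s s k) = (\<Sum>k\<in>UNIV. \<beta> j $ k *s weight_map \<beta> (s k))"
        by (simp add: weight_map_def vec_eq_iff sum_distrib_left sum_distrib_right mult.assoc)
          (auto intro: sum.swap)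
      moreover have "(\<Sum>k\<in>UNIV. \<beta> j $ k *s axis k 1) = \<beta> j"
        by (simp add: vec_eq_iff axis_def if_distrib[of "\<lambda>x. _ * x"] cong: if_cong)
      ultimately have "weight_map \<beta> y = 0"
        by (simp add: y_def s) (simp add: weight_map_def vec_eq_iff left_diff_distrib sum_subtractf)
      then have "c \<bullet> real_vec y = 0"
        by (intro c0) (simp add: relation_lattice_def)
      moreover have "real_vec y = axis j 1 - (\<Sum>k\<in>UNIV. of_int (\<beta> j $ k) *\<^sub>R real_vec (s k))"
        by (simp add: y_def vec_eq_iff axis_def)
      ultimately have "c \<bullet> axis j 1 = (\<Sum>k\<in>UNIV. of_int (\<beta> j $ k) * (c \<bullet> real_vec (s k)))"
        by (simp add: inner_diff_right inner_sum_right)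
      then show ?thesis
        by (simp add: inner_axis a_def inner_vec_def[of _ "real_vec (\<beta> j)"] mult.commute)
    qed
    then show ?thesis by (intro exI[of _ a]) (simp add: vec_eq_iff)
  qed
  have 2: "(\<chi> j. a \<bullet> real_vec (\<beta> j)) \<bullet> real_vec (b k) = 0" for a k
  proof -
    have "(\<Sum>j\<in>UNIV. of_int (b k $ j) *\<^sub>R real_vec (\<beta> j)) = real_vec (weight_map \<beta> (b k))"
      by (simp add: weight_map_def vec_eq_iff)
    also have "\<dots> = 0"
      using basis_in_lattice[OF basis, of k] by (simp add: relation_lattice_def)
    finally have "a \<bullet> (\<Sum>j\<in>UNIV. of_int (b k $ j) *\<^sub>R real_vec (\<beta> j)) = 0" by simp
    then show ?thesis
      by (simp add: inner_sum_right inner_vec_def[of _ "real_vec (b k)"] mult.commute)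
  qed
  show ?thesis
    unfolding ray_relations_def orth_iff orthogonal_weights_def
    using 1 2 by (fastforce simp: image_iff)
qed

lemma dim_ray_relations:
  fixes \<beta> :: "'n::finite \<Rightarrow> int ^ 'r::finite" and b :: "'d::finite \<Rightarrow> int ^ 'n"
  assumes surj: "surj (weight_map \<beta>)" and basis: "int_basis b (relation_lattice \<beta>)"
  shows "dim (ray_relations b \<Gamma>) = dim (orthogonal_weights \<beta> {j. real_vec (ray b j) \<notin> \<Gamma>})"
  unfolding ray_relations_eq[OF assms]
proof (rule dim_image_eq)
  show lin: "linear (\<lambda>a. \<chi> j. a \<bullet> real_vec (\<beta> j))"
    by (intro linearI) (simp_all add: vec_eq_iff inner_add_left)
  have "a = 0" if "(\<chi> j. a \<bullet> real_vec (\<beta> j)) = 0" for a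
  proof -
    have "a \<in> orthogonal_weights \<beta> UNIV"
      using that by (simp add: vec_eq_iff orthogonal_weights_def)
    then show ?thesis by (simp add: orthogonal_all_weights[OF surj])
  qed
  then have "inj (\<lambda>a. \<chi> j. a \<bullet> real_vec (\<beta> j))"
    by (simp add: linear_injective_0[OF lin])
  then show "inj_on (\<lambda>a. \<chi> j. a \<bullet> real_vec (\<beta> j)) (span (orthogonal_weights \<beta> {j. real_vec (ray b j) \<notin> \<Gamma>}))"
    by (rule inj_on_subset) simp
qed

text \<open>The integral points of the line are the multiples of \<open>l\<close>, so the chosen
  generator really generates \<open>circuit_lattice\<close>. Then \<open>l\<close> is a multiple of
  it, and by primitivity the factor is a sign.\<close>

lemma circuit_gen_cases:
  assumes l: "primitive_vec l"
    and orth: "orthogonal_weights \<beta> {j. real_vec (ray b j) \<notin> \<Gamma>} = span {real_vec l}"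
  shows "circuit_gen \<beta> b \<Gamma> = l \<or> circuit_gen \<beta> b \<Gamma> = - l"
proof -
  have "l' \<in> circuit_lattice \<beta> b \<Gamma> \<longleftrightarrow> real_vec l' \<in> span {real_vec l}" for l'
    unfolding orth[symmetric] real_vec_in_orthogonal_weights by (auto simp: circuit_lattice_def)
  moreover have "real_vec l' \<in> span {real_vec l} \<longleftrightarrow> l' \<in> range (\<lambda>k. k *s l)" for l'
  proof
    assume "real_vec l' \<in> span {real_vec l}"
    then obtain t where "real_vec l' = t *\<^sub>R real_vec l" by (auto simp: span_singleton)
    then obtain k where "l' = k *s l" using primitive_real_multiple[OF l] by metis
    then show "l' \<in> range (\<lambda>k. k *s l)" by blast
  qed (auto simp: span_singleton)
  ultimately have lattice: "circuit_lattice \<beta> b \<Gamma> = range (\<lambda>k. k *s l)" by blast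
  then have "circuit_lattice \<beta> b \<Gamma> = range (\<lambda>k. k *s circuit_gen \<beta> b \<Gamma>)"
    unfolding circuit_gen_def by (rule someI)
  moreover have "l \<in> circuit_lattice \<beta> b \<Gamma>"
    unfolding lattice by (rule range_eqI[of _ _ 1]) simp
  ultimately obtain k where k: "l = k *s circuit_gen \<beta> b \<Gamma>" by auto
  then have "\<bar>k\<bar> = 1" using l unfolding primitive_vec_def by blast
  then have "k = 1 \<or> k = - 1" by linarith
  then show ?thesis using k by (auto simp: vec_eq_iff)
qed

lemma arrangement_normal_circuit_gen:
  fixes \<beta> :: "'n::finite \<Rightarrow> int ^ 'r::finite" and b :: "'d::finite \<Rightarrow> int ^ 'n"
  assumes "surj (weight_map \<beta>)" "int_basis b (relation_lattice \<beta>)" and circ: "circuit b \<Gamma>"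
  shows "arrangement_normal \<beta> (circuit_gen \<beta> b \<Gamma>)"
proof -
  define J where "J = {j. real_vec (ray b j) \<notin> \<Gamma>}"
  have "dim (orthogonal_weights \<beta> J) = 1"
    using circ dim_ray_relations[OF assms(1,2), of \<Gamma>] by (simp add: circuit_def J_def)
  then obtain B where B: "B \<subseteq> orthogonal_weights \<beta> J" "independent B"
      "orthogonal_weights \<beta> J \<subseteq> span B" "card B = 1"
    by (metis basis_exists)
  then obtain a where a: "B = {a}" by (meson card_1_singletonE)
  have "a \<noteq> 0" using B(2) a by (metis dependent_zero insertI1)
  have "span {a} \<subseteq> orthogonal_weights \<beta> J"
    using B(1) a by (intro span_minimal subspace_orthogonal_weights) simp
  then have aJ: "orthogonal_weights \<beta> J = span {a}" using B(3) a by blast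
  obtain l t where l: "primitive_vec l" "real_vec l = t *\<^sub>R a" "t > 0"
    by (rule exists_primitive_multiple[OF \<open>a \<noteq> 0\<close> aJ])
  then have lJ: "orthogonal_weights \<beta> J = span {real_vec l}"
    using aJ by (simp add: span_scaleR_singleton)
  \<comment> \<open>Weights of rays in the circuit may be orthogonal to \<open>l\<close> too; the
    additional equations only shrink the annihilator, which therefore stays inside the line.\<close>
  have "J \<subseteq> {j. pairing l (\<beta> j) = (0::int)}"
    using real_vec_in_orthogonal_weights[of l \<beta> J] lJ by (auto simp: span_base)
  then have "orthogonal_weights \<beta> {j. pairing l (\<beta> j) = (0::int)} \<subseteq> orthogonal_weights \<beta> J"
    by (auto simp: orthogonal_weights_def)
  then have "arrangement_normal \<beta> l"
    using l lJ by (simp add: arrangement_normal_def)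
  then show ?thesis
    using circuit_gen_cases[OF l(1) lJ[unfolded J_def]] by auto
qed

text \<open>By quasi-symmetry the weights orthogonal to \<open>l\<close> sum to zero, so their indicator function lies
  in \<open>relation_lattice \<beta>\<close>; as a functional it exposes the face whose rays have
  weights not orthogonal to \<open>l\<close>.\<close>

lemma arrangement_normal_imp_circuit:
  fixes \<beta> :: "'n::finite \<Rightarrow> int ^ 'r::finite" and b :: "'d::finite \<Rightarrow> int ^ 'n"
  assumes surj: "surj (weight_map \<beta>)" and basis: "int_basis b (relation_lattice \<beta>)"
    and qs: "quasi_symmetric \<beta>" and normal: "arrangement_normal \<beta> l"
  obtains \<Gamma> where "circuit b \<Gamma>" "circuit_gen \<beta> b \<Gamma> = l \<or> circuit_gen \<beta> b \<Gamma> = - l"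
proof -
  define x :: "int ^ 'n" where "x = (\<chi> j. of_bool (pairing l (\<beta> j) = (0::int)))"
  have "x \<in> relation_lattice \<beta>"
    using quasi_symmetric_sum_orthogonal[OF qs, of l]
    by (simp add: x_def relation_lattice_def weight_map_def)
  then obtain p where p: "\<And>j. pairing p (ray b j) = x $ j"
    using relation_functional[OF basis] by metis
  have "(\<chi> j. 1) \<in> relation_lattice \<beta>"
  proof -
    have "(\<Sum>j\<in>UNIV. \<beta> j) = 0"
      \<comment> \<open>Every weight is orthogonal to 0, so all weights together sum to zero. This
        provides a functional of value 1 on all rays, as the choice in \<open>height\<close>
        requires.\<close>
      using quasi_symmetric_sum_orthogonal[OF qs, of 0] by (simp add: pairing_def)
    then show ?thesis by (simp add: relation_lattice_def weight_map_def vec_eq_iff)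
  qed
  then obtain m where "\<And>j. pairing m (ray b j) = (\<chi> j. 1) $ j"
    using relation_functional[OF basis] by blast
  then have "\<exists>m. \<forall>j. pairing m (ray b j) = 1" by auto
  then have "\<forall>j. pairing (height b) (ray b j) = 1"
    unfolding height_def by (rule someI_ex)
  then have height: "pairing (height b) (ray b j) = 1" for j by blast
  have ray_Delta: "real_vec (ray b j) \<in> Delta b" for j
    using height[of j] by (simp add: Delta_def pairing_real inner_real_vec hull_inc)
  have "convex_cone hull range (\<lambda>i. real_vec (ray b i)) \<subseteq> {y. real_vec p \<bullet> y \<ge> 0}"
    by (intro hull_minimal convex_cone_halfspace_ge) (auto simp: inner_real_vec p x_def)
  then have nonneg: "real_vec p \<bullet> y \<ge> 0" if "y \<in> Delta b" for y
    using that by (auto simp: Delta_def)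
  have "convex (Delta b)"
    unfolding Delta_def pairing_real
    by (intro convex_Int convex_convex_cone_hull convex_hyperplane)
  define \<Gamma> where "\<Gamma> = Delta b \<inter> {y. real_vec p \<bullet> y = 0}"
  have face: "\<Gamma> face_of Delta b"
    unfolding \<Gamma>_def by (intro face_of_Int_supporting_hyperplane_ge nonneg \<open>convex (Delta b)\<close>)
  have "{j. real_vec (ray b j) \<notin> \<Gamma>} = {j. pairing l (\<beta> j) = (0::int)}"
    using ray_Delta by (auto simp: \<Gamma>_def inner_real_vec p x_def)
  then have orth: "orthogonal_weights \<beta> {j. real_vec (ray b j) \<notin> \<Gamma>} = span {real_vec l}"
    and l: "primitive_vec l"
    using normal by (auto simp: arrangement_normal_iff)
  moreover have "real_vec l \<noteq> 0" using l by (simp add: primitive_vec_def)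
  ultimately have "circuit b \<Gamma>"
    using face by (simp add: circuit_def dim_ray_relations[OF surj basis])
  then show ?thesis
    using that circuit_gen_cases[OF l orth] by blast
qed

section \<open>The branch of the logarithm\<close>

text \<open>Only negative pairings produce signs, so in the product the exponent of -1 adds up to
  \<open>neg_sum\<close>.\<close>

lemma powi_self_eq: "of_int p powi p = (- 1) ^ nat (- p) * \<bar>real_of_int p\<bar> powi p"
proof (cases "p \<ge> 0")
  case False
  then have "p = - \<bar>p\<bar>" by simp
  then obtain q where q: "p = - int q" by (metis zero_le_imp_eq_int abs_ge_zero)
  show ?thesis
    by (simp add: q power_int_minus power_minus[of "real q"] flip: power_inverse)
qed simp

text \<open>On the real axis the argument is 0 or pi, and division by two pi i turns it into 0 or
  1/2 and sends the logarithm of the modulus to the imaginary part with a minus sign.\<close>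

lemma Log_br_of_real: "Log_br (of_real x) =
    of_real (if x < 0 then 1 / 2 else 0) - \<i> * of_real (ln \<bar>x\<bar> / (2 * pi))"
  by (simp add: Log_br_def Arg2pi_of_real field_simps)

lemma of_rat_complex: "(of_rat q :: complex) = of_real (of_rat q)"
  by (cases q rule: Rat_cases_nonzero) (auto simp: of_rat_rat)

lemma Log_br_circuit:
  fixes \<beta> :: "'n::finite \<Rightarrow> int ^ 'r::finite"
  assumes qs: "quasi_symmetric \<beta>"
  obtains m :: int where
    "Log_br (of_rat (\<Prod>j\<in>UNIV. of_int (pairing l (\<beta> j)) powi pairing l (\<beta> j))) =
       of_real (eta \<beta> l / 2) + of_int m + \<i> * of_real (pairing l (shift_vec \<beta>))"
proof -
  define c where "c = (\<Prod>j\<in>UNIV. real_of_int (pairing l (\<beta> j)) powi pairing l (\<beta> j))"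
  define d where "d = (\<Prod>j\<in>UNIV. \<bar>real_of_int (pairing l (\<beta> j))\<bar> powi pairing l (\<beta> j))"
  \<comment> \<open>A zero pairing gives \<open>0 powi 0 = 1\<close>, so the product
    \<open>d\<close> stays positive and its logarithm is a sum.\<close>
  have factor_pos: "\<bar>real_of_int p\<bar> powi p > 0" for p
    by (cases "p = 0") auto
  then have "d > 0" by (simp add: d_def prod_pos)
  have c: "c = (- 1) ^ neg_sum \<beta> l * d"
    unfolding c_def d_def neg_sum_def
    by (subst powi_self_eq) (simp add: prod.distrib power_sum)
  have "\<bar>real_of_int p\<bar> powi p \<noteq> 0" for p
    using factor_pos[of p] by simp
  moreover have "ln (\<bar>real_of_int p\<bar> powi p) = of_int p * ln \<bar>real_of_int p\<bar>" for p
    by (cases "p = 0") (auto simp: ln_powr simp flip: powr_real_of_int')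
  ultimately have "ln d = - (2 * pi) * pairing l (shift_vec \<beta>)"
    unfolding d_def quasi_symmetric_entropy[OF qs, symmetric] by (simp add: ln_prod)
  moreover have "\<bar>c\<bar> = d"
    using \<open>d > 0\<close> by (simp add: c abs_mult power_abs)
  ultimately have ln_c: "ln \<bar>c\<bar> / (2 * pi) = - pairing l (shift_vec \<beta>)"
    by simp
  have c_neg: "c < 0 \<longleftrightarrow> odd (neg_sum \<beta> l)"
    using \<open>d > 0\<close> by (cases "even (neg_sum \<beta> l)") (auto simp: c)
  \<comment> \<open>Both 0 or 1/2, according to parity, and half of \<open>neg_sum\<close> differ by
    exactly this integer.\<close>
  define m where "m = - int (neg_sum \<beta> l div 2)"
  have "(if c < 0 then 1 / 2 else 0) = eta \<beta> l / 2 + of_int m"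
  proof (cases "even (neg_sum \<beta> l)")
    case True
    then show ?thesis unfolding c_neg eta_eq m_def by (elim evenE) simp
  next
    case False
    then show ?thesis unfolding c_neg eta_eq m_def by (elim oddE) (simp add: field_simps)
  qed
  then have "Log_br (of_real c) = of_real (eta \<beta> l / 2 + of_int m) + \<i> * of_real (pairing l (shift_vec \<beta>))"
    unfolding Log_br_of_real ln_c by simp
  moreover have "of_rat (\<Prod>j\<in>UNIV. of_int (pairing l (\<beta> j)) powi pairing l (\<beta> j)) = c"
    by (simp add: c_def of_rat_prod power_int_def of_rat_power of_rat_inverse if_distrib[of of_rat] cong: if_cong)
  ultimately show ?thesis using that[of m] by (simp add: of_rat_complex)
qed

section \<open>The polytope as a zonotope\<close>

text \<open>The support function of the zonotope below. The factor 1/4 arises because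
  \<open>eta\<close> is half the sum of absolute values and the polytope is bounded by
  \<open>eta / 2\<close>.\<close>

definition support_fun :: "('n::finite \<Rightarrow> int ^ 'r::finite) \<Rightarrow> real ^ 'r \<Rightarrow> real" where
  "support_fun \<beta> a = (\<Sum>j\<in>UNIV. \<bar>a \<bullet> real_vec (\<beta> j)\<bar>) / 4"

text \<open>Written as the linear image of a box, so that it is visibly a polytope.\<close>

definition zonotope :: "('n::finite \<Rightarrow> int ^ 'r::finite) \<Rightarrow> (real ^ 'r) set" where
  "zonotope \<beta> = (\<lambda>c. \<Sum>j\<in>UNIV. c $ j *\<^sub>R real_vec (\<beta> j)) ` cbox (\<chi> j. - 1 / 4) (\<chi> j. 1 / 4)"

text \<open>A maximiser of \<open>a\<close> on the zonotope. As \<open>sgn 0 = 0\<close>, weights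
  orthogonal to \<open>a\<close> get the middle coefficient, which leaves room to move along them in
  both directions.\<close>

definition extreme_sum :: "('n::finite \<Rightarrow> int ^ 'r::finite) \<Rightarrow> real ^ 'r \<Rightarrow> real ^ 'r" where
  "extreme_sum \<beta> a = (\<Sum>j\<in>UNIV. (sgn (a \<bullet> real_vec (\<beta> j)) / 4) *\<^sub>R real_vec (\<beta> j))"

lemma zonotopeE:
  fixes \<beta> :: "'n::finite \<Rightarrow> int ^ 'r::finite"
  assumes "x \<in> zonotope \<beta>"
  obtains c where "\<And>j. \<bar>c j\<bar> \<le> 1 / 4" "x = (\<Sum>j\<in>UNIV. c j *\<^sub>R real_vec (\<beta> j))"
proof -
  from assms obtain c :: "real ^ 'n" where c: "c \<in> cbox (\<chi> j. - 1 / 4) (\<chi> j. 1 / 4)"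
    "x = (\<Sum>j\<in>UNIV. c $ j *\<^sub>R real_vec (\<beta> j))"
    unfolding zonotope_def by auto
  have bounds: "- 1 / 4 \<le> c $ j" "c $ j \<le> 1 / 4" for j
    using c(1) by (simp_all add: mem_box_cart)
  have "\<bar>c $ j\<bar> \<le> 1 / 4" for j
    using bounds[of j] by linarith
  then show ?thesis using that[of "($) c"] c(2) by simp
qed

lemma zonotopeI:
  assumes "\<And>j. \<bar>c j\<bar> \<le> 1 / 4"
  shows "(\<Sum>j\<in>UNIV. c j *\<^sub>R real_vec (\<beta> j)) \<in> zonotope \<beta>"
proof -
  have "- 1 / 4 \<le> c j" "c j \<le> 1 / 4" for j
    using assms[of j] by linarith+
  then have "(\<chi> j. c j) \<in> cbox (\<chi> j. - 1 / 4) (\<chi> j. 1 / 4)"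
    by (simp add: mem_box_cart)
  then show ?thesis unfolding zonotope_def by (rule rev_image_eqI) simp
qed

lemma polytope_zonotope: "polytope (zonotope \<beta>)"
  unfolding zonotope_def
  by (intro polytope_linear_image polytope_interval linearI)
    (simp_all add: scaleR_add_left sum.distrib scaleR_sum_right)

lemma extreme_sum_in_zonotope: "extreme_sum \<beta> a \<in> zonotope \<beta>"
  unfolding extreme_sum_def by (rule zonotopeI) (simp add: abs_sgn_eq)

lemma inner_extreme_sum: "a \<bullet> extreme_sum \<beta> a = support_fun \<beta> a"
  by (simp add: extreme_sum_def support_fun_def inner_sum_right sum_divide_distrib
      abs_sgn mult.commute)

lemma inner_weight_le:
  assumes "\<bar>c\<bar> \<le> 1 / 4"
  shows "c * x \<le> \<bar>x :: real\<bar> / 4"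
proof -
  have "c * x \<le> \<bar>c\<bar> * \<bar>x\<bar>" by (metis abs_ge_self abs_mult)
  also have "\<dots> \<le> 1 / 4 * \<bar>x\<bar>" using assms by (intro mult_right_mono) auto
  finally show ?thesis by simp
qed

lemma zonotope_le_support_fun: "x \<in> zonotope \<beta> \<Longrightarrow> a \<bullet> x \<le> support_fun \<beta> a"
  by (auto elim!: zonotopeE simp: support_fun_def inner_sum_right sum_divide_distrib
      intro!: sum_mono inner_weight_le)

lemma support_fun_uminus: "support_fun \<beta> (- a) = support_fun \<beta> a"
  by (simp add: support_fun_def)

lemma support_fun_scaleR: "t \<ge> 0 \<Longrightarrow> support_fun \<beta> (t *\<^sub>R a) = t * support_fun \<beta> a"
  by (simp add: support_fun_def abs_mult sum_distrib_left)

lemma support_fun_real_vec: "quasi_symmetric \<beta> \<Longrightarrow> support_fun \<beta> (real_vec l) = eta \<beta> l / 2"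
  by (simp add: support_fun_def eta_eq abs_sum_eq_neg_sum)

text \<open>The polytope \<open>nabla_bar\<close> is tested by integral functionals only. A point
  outside the zonotope is separated from it by a real functional; strict separation is an open
  condition, so a rational functional separates too, and clearing denominators makes it
  integral.\<close>

lemma nabla_bar_eq_zonotope:
  fixes \<beta> :: "'n::finite \<Rightarrow> int ^ 'r::finite"
  assumes qs: "quasi_symmetric \<beta>"
  shows "nabla_bar \<beta> = zonotope \<beta>"
proof (intro antisym subsetI)
  fix x assume x: "x \<in> zonotope \<beta>"
  have "- (eta \<beta> l / 2) \<le> pairing l x \<and> pairing l x \<le> eta \<beta> l / 2" for l
    using zonotope_le_support_fun[OF x, of "real_vec l"] zonotope_le_support_fun[OF x, of "- real_vec l"]
    by (simp add: pairing_real support_fun_uminus support_fun_real_vec[OF qs])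
  then show "x \<in> nabla_bar \<beta>" by (simp add: nabla_bar_def)
next
  fix x assume x: "x \<in> nabla_bar \<beta>"
  show "x \<in> zonotope \<beta>"
  proof (rule ccontr)
    assume "x \<notin> zonotope \<beta>"
    then obtain a b where ab: "a \<bullet> x < b" "\<And>y. y \<in> zonotope \<beta> \<Longrightarrow> a \<bullet> y > b"
      using separating_hyperplane_closed_point[OF polytope_imp_convex polytope_imp_closed]
        polytope_zonotope by metis
    define U where "U = {a. support_fun \<beta> a < a \<bullet> x}"
    have "open U"
      unfolding U_def support_fun_def by (intro open_Collect_less continuous_intros) auto
    moreover have "- a \<in> U"
      using ab(1) ab(2)[OF extreme_sum_in_zonotope, of "- a"] inner_extreme_sum[of "- a" \<beta>]
      by (simp add: U_def)
    moreover define D :: "(real ^ 'r) set" where "D = (\<Union>f \<in> Basis \<rightarrow> \<rat>. {\<Sum>i \<in> Basis. f i *\<^sub>R i})"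
    moreover have "closure D = UNIV"
      unfolding D_def by (rule closure_rational_coordinates)
    ultimately have "U \<inter> D \<noteq> {}"
      using open_Int_closure_eq_empty[of U D] by auto
    then obtain f where f: "f \<in> Basis \<rightarrow> \<rat>" and U: "(\<Sum>i \<in> Basis. f i *\<^sub>R i) \<in> U"
      unfolding D_def by blast
    define d where "d = (\<Sum>i \<in> Basis. f i *\<^sub>R i)"
    have "d $ k \<in> \<rat>" for k
    proof -
      have "d $ k = d \<bullet> axis k 1" by (simp add: inner_axis)
      also have "\<dots> = f (axis k 1)"
        unfolding d_def by (rule inner_sum_left_Basis) (simp add: axis_in_Basis_iff)
      also have "\<dots> \<in> \<rat>" using f by (auto simp: axis_in_Basis_iff)
      finally show ?thesis .
    qed
    then obtain q l where q: "q > 0" and l: "\<And>k. of_int (l $ k) = of_int q * d $ k"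
      by (rule common_denominator) blast
    have rl: "real_vec l = of_int q *\<^sub>R d" using l by (simp add: vec_eq_iff)
    have "support_fun \<beta> d < d \<bullet> x" using U by (simp add: U_def d_def)
    then have "support_fun \<beta> (real_vec l) < real_vec l \<bullet> x"
      using q by (simp add: rl support_fun_scaleR)
    moreover have "pairing l x \<le> eta \<beta> l / 2" using x by (simp add: nabla_bar_def)
    ultimately show False by (simp add: support_fun_real_vec[OF qs] pairing_real)
  qed
qed

text \<open>Split \<open>y\<close> into its part in the span and an orthogonal part
  \<open>w\<close>. The latter lies in the annihilator, hence is a multiple of \<open>a\<close>, and
  is orthogonal to \<open>a\<close>, hence zero.\<close>

lemma span_weights_eq_hyperplane:
  assumes "orthogonal_weights \<beta> J = span {a}"
  shows "span ((\<lambda>j. real_vec (\<beta> j)) ` J) = {y. a \<bullet> y = 0}"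
proof (intro antisym subsetI)
  have "a \<in> orthogonal_weights \<beta> J" by (simp add: assms span_base)
  then have "span ((\<lambda>j. real_vec (\<beta> j)) ` J) \<subseteq> {y. a \<bullet> y = 0}"
    by (intro span_minimal subspace_hyperplane) (auto simp: orthogonal_weights_def)
  then show "y \<in> {y. a \<bullet> y = 0}" if "y \<in> span ((\<lambda>j. real_vec (\<beta> j)) ` J)" for y
    using that by blast
  fix y assume y: "y \<in> {y. a \<bullet> y = 0}"
  obtain v w where v: "v \<in> span ((\<lambda>j. real_vec (\<beta> j)) ` J)"
    and w: "\<And>u. u \<in> span ((\<lambda>j. real_vec (\<beta> j)) ` J) \<Longrightarrow> orthogonal w u" and vw: "y = v + w"
    using orthogonal_subspace_decomp_exists[of "(\<lambda>j. real_vec (\<beta> j)) ` J" y] by metis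
  have "w \<in> orthogonal_weights \<beta> J"
    using w[OF span_base] by (auto simp: orthogonal_weights_def orthogonal_def)
  then obtain t where t: "w = t *\<^sub>R a" by (auto simp: assms span_singleton)
  have "a \<bullet> v = 0"
    using v \<open>span ((\<lambda>j. real_vec (\<beta> j)) ` J) \<subseteq> {y. a \<bullet> y = 0}\<close> by blast
  then have "a \<bullet> w = 0" using y vw by (simp add: inner_add_right)
  then have "w = 0" using t by auto
  then show "y \<in> span ((\<lambda>j. real_vec (\<beta> j)) ` J)" using v vw by simp
qed

lemma affine_add_span:
  assumes "affine A" "x \<in> A" "t \<noteq> 0" and B: "\<And>v. v \<in> B \<Longrightarrow> x + t *\<^sub>R v \<in> A" and y: "y \<in> span B"
  shows "x + y \<in> A"
proof -
  have sub: "subspace ((\<lambda>z. - x + z) ` A)"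
    using affine_diffs_subspace[OF assms(1,2)] by simp
  have "v \<in> (\<lambda>z. - x + z) ` A" if "v \<in> B" for v
  proof -
    have "t *\<^sub>R v \<in> (\<lambda>z. - x + z) ` A"
      by (rule rev_image_eqI[OF B[OF that]]) simp
    from subspace_scale[OF sub this, of "1 / t"] show ?thesis
      using \<open>t \<noteq> 0\<close> by simp
  qed
  then have "y \<in> (\<lambda>z. - x + z) ` A"
    using y sub by (meson span_minimal subset_eq)
  then show ?thesis by auto
qed

lemma aff_dim_zonotope:
  fixes \<beta> :: "'n::finite \<Rightarrow> int ^ 'r::finite"
  assumes "surj (weight_map \<beta>)"
  shows "aff_dim (zonotope \<beta>) = CARD('r)"
proof -
  have zero: "0 \<in> zonotope \<beta>" using zonotopeI[of "\<lambda>_. 0" \<beta>] by simp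
  have "(1 / 4) *\<^sub>R real_vec (\<beta> j) \<in> zonotope \<beta>" for j
    using zonotopeI[of "\<lambda>i. if i = j then 1 / 4 else 0" \<beta>]
    by (simp add: if_distrib[of "\<lambda>x. x *\<^sub>R _"] cong: if_cong)
  then have "4 *\<^sub>R (1 / 4) *\<^sub>R real_vec (\<beta> j) \<in> span (zonotope \<beta>)" for j
    by (intro span_scale span_base)
  then have "span (range (\<lambda>j. real_vec (\<beta> j))) \<subseteq> span (zonotope \<beta>)"
    by (intro span_minimal) auto
  moreover have "span (range (\<lambda>j. real_vec (\<beta> j))) = UNIV"
    \<comment> \<open>With normal 0 the hyperplane degenerates to the whole space.\<close>
    using span_weights_eq_hyperplane[of \<beta> UNIV 0] by (simp add: orthogonal_all_weights[OF assms])
  ultimately have "dim (zonotope \<beta>) = CARD('r)"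
    by (simp add: top.extremum_unique flip: dim_eq_full)
  then show ?thesis by (simp add: aff_dim_zero hull_inc zero)
qed

section \<open>Facets\<close>

text \<open>On a face where \<open>a\<close> is maximal, every weight not orthogonal to
  \<open>a\<close> has its extreme coefficient. So a functional killing the orthogonal weights is
  constant on the facet, and since the facet spans a hyperplane it is a multiple of
  \<open>a\<close>.\<close>

lemma facet_imp_arrangement_normal:
  fixes \<beta> :: "'n::finite \<Rightarrow> int ^ 'r::finite"
  assumes surj: "surj (weight_map \<beta>)" and qs: "quasi_symmetric \<beta>" and F: "F facet_of nabla_bar \<beta>"
  obtains l where "arrangement_normal \<beta> l" "affine hull F = {x. real_vec l \<bullet> x = eta \<beta> l / 2}"
proof -
  have F: "F face_of zonotope \<beta>" "F \<noteq> {}" "aff_dim F = CARD('r) - 1"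
    using F by (auto simp: facet_of_def nabla_bar_eq_zonotope[OF qs] aff_dim_zonotope[OF surj])
  then have "F \<noteq> zonotope \<beta>" using aff_dim_zonotope[OF surj] by auto
  moreover have "F exposed_face_of zonotope \<beta>"
    using F by (simp add: exposed_face_of_polyhedron polytope_imp_polyhedron polytope_zonotope)
  ultimately obtain a c where a: "a \<noteq> 0" "zonotope \<beta> \<subseteq> {x. a \<bullet> x \<le> c}" "F = zonotope \<beta> \<inter> {x. a \<bullet> x = c}"
    using F(2) unfolding exposed_face_of by blast
  have c: "c = support_fun \<beta> a"
  proof (rule antisym)
    obtain x where "x \<in> F" using F(2) by blast
    then show "c \<le> support_fun \<beta> a" using a(3) zonotope_le_support_fun[of x \<beta> a] by auto
    show "support_fun \<beta> a \<le> c"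
      using a(2) extreme_sum_in_zonotope[of \<beta> a] by (auto simp flip: inner_extreme_sum)
  qed
  have hull: "affine hull F = {x. a \<bullet> x = c}"
  proof (rule affine_dim_equal)
    show "affine hull F \<subseteq> {x. a \<bullet> x = c}"
      using a(3) by (intro hull_minimal affine_hyperplane) auto
    show "aff_dim (affine hull F) = aff_dim {x. a \<bullet> x = c}"
      using F(3) a(1) by simp
  qed (use F(2) affine_hyperplane in auto)
  define J where "J = {j. a \<bullet> real_vec (\<beta> j) = 0}"
  have "a' \<in> span {a}" if a': "a' \<in> orthogonal_weights \<beta> J" for a'
  proof -
    have "a' \<bullet> x = a' \<bullet> extreme_sum \<beta> a" if "x \<in> F" for x
    proof -
      have "x \<in> zonotope \<beta>" and ax: "a \<bullet> x = support_fun \<beta> a" using that a(3) c by auto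
      then obtain k where k: "\<And>j. \<bar>k j\<bar> \<le> 1 / 4" and x: "x = (\<Sum>j\<in>UNIV. k j *\<^sub>R real_vec (\<beta> j))"
        by (elim zonotopeE) blast
      have "(\<Sum>j\<in>UNIV. \<bar>a \<bullet> real_vec (\<beta> j)\<bar> / 4 - k j * (a \<bullet> real_vec (\<beta> j))) = 0"
        using ax by (simp add: x support_fun_def inner_sum_right sum_subtractf sum_divide_distrib)
      \<comment> \<open>The terms are nonnegative and sum to zero, so equality holds in each of
        them.\<close>
      then have eq: "\<bar>a \<bullet> real_vec (\<beta> j)\<bar> / 4 - k j * (a \<bullet> real_vec (\<beta> j)) = 0" for j
        using inner_weight_le[OF k] by (subst (asm) sum_nonneg_eq_0_iff) auto
      have "k j * (a' \<bullet> real_vec (\<beta> j)) = sgn (a \<bullet> real_vec (\<beta> j)) / 4 * (a' \<bullet> real_vec (\<beta> j))" for j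
      proof (cases "j \<in> J")
        case True
        then show ?thesis using a' by (simp add: orthogonal_weights_def)
      next
        case False
        then have "a \<bullet> real_vec (\<beta> j) \<noteq> 0" by (simp add: J_def)
        moreover have "(k j - sgn (a \<bullet> real_vec (\<beta> j)) / 4) * (a \<bullet> real_vec (\<beta> j)) = 0"
          using eq[of j] by (auto simp: abs_sgn algebra_simps)
        ultimately have "k j = sgn (a \<bullet> real_vec (\<beta> j)) / 4" by simp
        then show ?thesis by simp
      qed
      then show ?thesis
        unfolding x extreme_sum_def inner_sum_right inner_scaleR_right by (intro sum.cong refl)
    qed
    then have "affine hull F \<subseteq> {x. a' \<bullet> x = a' \<bullet> extreme_sum \<beta> a}"
      by (intro hull_minimal affine_hyperplane) auto
    then obtain t where "a' = t *\<^sub>R a"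
      unfolding hull by (rule hyperplane_subset_hyperplane[OF a(1)])
    then show ?thesis by (simp add: span_base span_scale)
  qed
  moreover have "span {a} \<subseteq> orthogonal_weights \<beta> J"
    by (intro span_minimal subspace_orthogonal_weights) (auto simp: orthogonal_weights_def J_def)
  ultimately have aJ: "orthogonal_weights \<beta> J = span {a}" by blast
  obtain l t where l: "primitive_vec l" "real_vec l = t *\<^sub>R a" "t > 0"
    by (rule exists_primitive_multiple[OF a(1) aJ])
  have "pairing l (\<beta> j) = (0::int) \<longleftrightarrow> a \<bullet> real_vec (\<beta> j) = 0" for j
    using inner_real_vec[of l "\<beta> j"] l(2,3)
    by (metis inner_scaleR_left mult_eq_0_iff of_int_eq_0_iff less_irrefl)
  then have "{j. pairing l (\<beta> j) = (0::int)} = J"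
    by (simp add: J_def)
  then have "arrangement_normal \<beta> l"
    using l aJ by (simp add: arrangement_normal_def span_scaleR_singleton)
  \<comment> \<open>The support function is homogeneous for positive factors, so passing from
    \<open>a\<close> to \<open>l\<close> rescales the constant in the same way.\<close>
  moreover have "eta \<beta> l / 2 = t * c"
    by (simp only: c l(2) support_fun_real_vec[OF qs, symmetric] support_fun_scaleR[OF less_imp_le[OF l(3)]])
  then have "affine hull F = {x. real_vec l \<bullet> x = eta \<beta> l / 2}"
    using l by (simp add: hull)
  ultimately show ?thesis using that by blast
qed

text \<open>The face exposed by \<open>l\<close> contains \<open>extreme_sum\<close> and its
  translates by a quarter of each orthogonal weight. These weights span the hyperplane orthogonal to
  \<open>l\<close>, so the face has codimension one.\<close>

lemma arrangement_normal_imp_facet: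
  fixes \<beta> :: "'n::finite \<Rightarrow> int ^ 'r::finite"
  assumes surj: "surj (weight_map \<beta>)" and qs: "quasi_symmetric \<beta>" and normal: "arrangement_normal \<beta> l"
  obtains F where "F facet_of nabla_bar \<beta>" "affine hull F = {x. real_vec l \<bullet> x = eta \<beta> l / 2}"
proof -
  define a where "a = real_vec l"
  define c where "c = support_fun \<beta> a"
  define J where "J = {j. pairing l (\<beta> j) = (0::int)}"
  define F where "F = zonotope \<beta> \<inter> {x. a \<bullet> x = c}"
  have "a \<noteq> 0" and aJ: "orthogonal_weights \<beta> J = span {a}"
    using normal by (auto simp: arrangement_normal_iff a_def J_def primitive_vec_def)
  have xF: "extreme_sum \<beta> a \<in> F"
    by (simp add: F_def c_def extreme_sum_in_zonotope inner_extreme_sum)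
  have xjF: "extreme_sum \<beta> a + (1 / 4) *\<^sub>R real_vec (\<beta> j) \<in> F" if "j \<in> J" for j
  proof -
    have j: "a \<bullet> real_vec (\<beta> j) = 0" using that by (simp add: a_def J_def inner_real_vec)
    have "extreme_sum \<beta> a + (1 / 4) *\<^sub>R real_vec (\<beta> j) =
        (\<Sum>i\<in>UNIV. (sgn (a \<bullet> real_vec (\<beta> i)) / 4 + (if i = j then 1 / 4 else 0)) *\<^sub>R real_vec (\<beta> i))"
      by (simp add: extreme_sum_def scaleR_add_left sum.distrib if_distrib[of "\<lambda>x. x *\<^sub>R _"] cong: if_cong)
    also have "\<dots> \<in> zonotope \<beta>"
      by (rule zonotopeI) (auto simp: j abs_sgn_eq)
    finally show ?thesis
      by (simp add: F_def inner_add_right j inner_extreme_sum c_def)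
  qed
  have hull: "affine hull F = {x. a \<bullet> x = c}"
  proof (intro antisym subsetI)
    have "affine hull F \<subseteq> {x. a \<bullet> x = c}"
      unfolding F_def by (intro hull_minimal affine_hyperplane) auto
    then show "x \<in> {x. a \<bullet> x = c}" if "x \<in> affine hull F" for x using that by blast
    fix x assume "x \<in> {x. a \<bullet> x = c}"
    then have "x - extreme_sum \<beta> a \<in> span ((\<lambda>j. real_vec (\<beta> j)) ` J)"
      by (simp add: span_weights_eq_hyperplane[OF aJ] inner_diff_right inner_extreme_sum c_def)
    then have "extreme_sum \<beta> a + (x - extreme_sum \<beta> a) \<in> affine hull F"
      by (rule affine_add_span[where t = "1 / 4", rotated -1])
        (use xF xjF in \<open>auto intro: hull_inc\<close>)
    then show "x \<in> affine hull F" by simp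
  qed
  have "aff_dim F = CARD('r) - 1"
    using aff_dim_affine_hull[of F] \<open>a \<noteq> 0\<close> unfolding hull by simp
  moreover have "F face_of zonotope \<beta>"
    unfolding F_def c_def
    by (intro face_of_Int_supporting_hyperplane_le zonotope_le_support_fun polytope_imp_convex polytope_zonotope)
  ultimately have "F facet_of nabla_bar \<beta>"
    using xF by (auto simp: facet_of_def nabla_bar_eq_zonotope[OF qs] aff_dim_zonotope[OF surj])
  then show ?thesis
    using that hull by (simp add: a_def c_def support_fun_real_vec[OF qs])
qed

section \<open>Comparison of the arrangements\<close>

lemma translate_hyperplane:
  fixes t :: "'a::comm_ring_1 ^ 'k"
  shows "(\<lambda>y. y + t) ` {y. pairing l y = c} = {y. pairing l y = c + pairing l t}"
proof (intro antisym subsetI)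
  fix y assume "y \<in> {y. pairing l y = c + pairing l t}"
  then show "y \<in> (\<lambda>y. y + t) ` {y. pairing l y = c}"
    by (intro rev_image_eqI[of "y - t"]) (auto simp: pairing_diff)
qed (auto simp: pairing_add)

lemma of_int_pairing: "pairing l (of_int_vec t) = of_int (pairing l t)"
  by (simp add: pairing_def of_int_vec_def)

text \<open>A lattice vector \<open>t\<close> shifts the constant by \<open>pairing l t\<close>, and
  primitivity of \<open>l\<close> makes every integer occur.\<close>

lemma real_HLS_eq:
  fixes \<beta> :: "'n::finite \<Rightarrow> int ^ 'r::finite"
  assumes surj: "surj (weight_map \<beta>)" and qs: "quasi_symmetric \<beta>"
  shows "real_HLS \<beta> = {{x. pairing l x = eta \<beta> l / 2 + of_int n} | l n. arrangement_normal \<beta> l}"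
proof (intro antisym subsetI)
  fix H assume "H \<in> real_HLS \<beta>"
  then obtain F and t :: "int ^ 'r" where F: "F facet_of nabla_bar \<beta>"
    and H: "H = (\<lambda>x. x + of_int_vec t) ` (affine hull F)"
    by (auto simp: real_HLS_def)
  obtain l where l: "arrangement_normal \<beta> l" "affine hull F = {x. pairing l x = eta \<beta> l / 2}"
    using facet_imp_arrangement_normal[OF surj qs F] by (auto simp: pairing_real)
  have "H = {x. pairing l x = eta \<beta> l / 2 + of_int (pairing l t)}"
    unfolding H l(2) translate_hyperplane by (simp add: of_int_pairing)
  then show "H \<in> {{x. pairing l x = eta \<beta> l / 2 + of_int n} | l n. arrangement_normal \<beta> l}"
    using l(1) by blast
next
  fix H :: "(real ^ 'r) set" assume "H \<in> {{x. pairing l x = eta \<beta> l / 2 + of_int n} | l n. arrangement_normal \<beta> l}"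
  then obtain l n where l: "arrangement_normal \<beta> l" and H: "H = {x. pairing l x = eta \<beta> l / 2 + of_int n}"
    by blast
  obtain F where F: "F facet_of nabla_bar \<beta>" "affine hull F = {x. pairing l x = eta \<beta> l / 2}"
    using arrangement_normal_imp_facet[OF surj qs l] by (auto simp: pairing_real)
  obtain t where t: "pairing l t = n"
    using primitive_pairing_surj[of l] l by (auto simp: arrangement_normal_def)
  have "H = (\<lambda>x. x + of_int_vec t) ` (affine hull F)"
    unfolding H F(2) translate_hyperplane by (simp add: of_int_pairing t)
  then show "H \<in> real_HLS \<beta>"
    using F(1) unfolding real_HLS_def by blast
qed

text \<open>Complexification works with equations, which a real hyperplane determines only up to a
  nonzero scalar; the scalar \<open>t\<close> cancels from the complex equation.\<close>

lemma H_HLS_eq: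
  fixes \<beta> :: "'n::finite \<Rightarrow> int ^ 'r::finite"
  assumes "surj (weight_map \<beta>)" and "quasi_symmetric \<beta>"
  shows "H_HLS \<beta> = {{y. pairing l y = of_real (eta \<beta> l / 2 + of_int n)} | l n. arrangement_normal \<beta> l}"
proof (intro antisym subsetI)
  fix H assume "H \<in> H_HLS \<beta>"
  then obtain a c where H: "H = {y. (\<Sum>k\<in>UNIV. of_real (a $ k) * y $ k) = of_real c}" and "a \<noteq> 0"
    and "{x. (\<Sum>k\<in>UNIV. a $ k * x $ k) = c} \<in> real_HLS \<beta>"
    unfolding H_HLS_def complexification_def by blast
  then have "{x. a \<bullet> x = c} \<in> real_HLS \<beta>" by (simp add: inner_vec_def)
  then obtain l n where l: "arrangement_normal \<beta> l"
    and eq: "{x. a \<bullet> x = c} = {x. real_vec l \<bullet> x = eta \<beta> l / 2 + of_int n}"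
    by (auto simp: real_HLS_eq[OF assms] pairing_real)
  have "real_vec l \<noteq> 0" using l by (auto simp: arrangement_normal_def primitive_vec_def)
  then obtain t where t: "a = t *\<^sub>R real_vec l" "c = t * (eta \<beta> l / 2 + of_int n)"
    by (rule hyperplane_subset_hyperplane[OF _ eq[symmetric, THEN equalityD1]])
  then have "t \<noteq> 0" using \<open>a \<noteq> 0\<close> by auto
  have "(\<Sum>k\<in>UNIV. of_real (a $ k) * y $ k) = of_real t * pairing l y" for y :: "complex ^ 'r"
    by (simp add: t pairing_def sum_distrib_left mult.assoc)
  then have "H = {y. pairing l y = of_real (eta \<beta> l / 2 + of_int n)}"
    using \<open>t \<noteq> 0\<close> by (simp add: H t(2) del: of_real_add)
  then show "H \<in> {{y. pairing l y = of_real (eta \<beta> l / 2 + of_int n)} | l n. arrangement_normal \<beta> l}"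
    using l by blast
next
  fix H :: "(complex ^ 'r) set"
  assume "H \<in> {{y. pairing l y = of_real (eta \<beta> l / 2 + of_int n)} | l n. arrangement_normal \<beta> l}"
  then obtain l n where l: "arrangement_normal \<beta> l"
    and H: "H = {y. pairing l y = of_real (eta \<beta> l / 2 + of_int n)}"
    by blast
  have "real_vec l \<noteq> 0" using l by (auto simp: arrangement_normal_def primitive_vec_def)
  moreover have "{x. (\<Sum>k\<in>UNIV. real_vec l $ k * x $ k) = eta \<beta> l / 2 + of_int n} \<in> real_HLS \<beta>"
    using l unfolding real_HLS_eq[OF assms] pairing_def real_vec_nth by blast
  moreover have "H = {y. (\<Sum>k\<in>UNIV. of_real (real_vec l $ k) * y $ k) = of_real (eta \<beta> l / 2 + of_int n)}"
    by (simp add: H pairing_def)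
  ultimately show "H \<in> H_HLS \<beta>"
    unfolding H_HLS_def complexification_def by blast
qed

lemma eta_uminus: "quasi_symmetric \<beta> \<Longrightarrow> eta \<beta> (- l) = eta \<beta> l"
  using support_fun_real_vec[of \<beta> l] support_fun_real_vec[of \<beta> "- l"]
  by (simp add: real_vec_uminus support_fun_uminus)

lemma H_disc_eq:
  fixes \<beta> :: "'n::finite \<Rightarrow> int ^ 'r::finite" and b :: "'d::finite \<Rightarrow> int ^ 'n"
  assumes surj: "surj (weight_map \<beta>)" and basis: "int_basis b (relation_lattice \<beta>)"
    and qs: "quasi_symmetric \<beta>"
  shows "H_disc \<beta> b =
    {{y. pairing l y = of_real (eta \<beta> l / 2 + of_int n) + \<i> * of_real (pairing l (shift_vec \<beta>))} | l n.
      arrangement_normal \<beta> l}" (is "_ = {?K l n | l n. _ l}")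
proof (intro antisym subsetI)
  \<comment> \<open>The integer \<open>m\<close> depends on the circuit alone, so it merely
    reindexes the family over all \<open>n\<close>.\<close>
  have disc: "\<exists>m. \<forall>n. disc_hyperplane \<beta> b \<Gamma> n = ?K (circuit_gen \<beta> b \<Gamma>) (m + n)" for \<Gamma>
  proof -
    obtain m :: int where m: "Log_br (of_rat (circuit_coeff \<beta> b \<Gamma>)) =
        of_real (eta \<beta> (circuit_gen \<beta> b \<Gamma>) / 2) + of_int m +
        \<i> * of_real (pairing (circuit_gen \<beta> b \<Gamma>) (shift_vec \<beta>))"
      using Log_br_circuit[OF qs, of "circuit_gen \<beta> b \<Gamma>"] unfolding circuit_coeff_def by blast
    show ?thesis
      by (intro exI[of _ m] allI) (simp add: disc_hyperplane_def m add_ac)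
  qed
  fix H
  {
    assume "H \<in> H_disc \<beta> b"
    then obtain \<Gamma> n where H: "H = disc_hyperplane \<beta> b \<Gamma> n" and circ: "circuit b \<Gamma>"
      by (auto simp: H_disc_def)
    obtain m where "H = ?K (circuit_gen \<beta> b \<Gamma>) (m + n)"
      using disc[of \<Gamma>] H by blast
    then show "H \<in> {?K l n | l n. arrangement_normal \<beta> l}"
      using arrangement_normal_circuit_gen[OF surj basis circ] by blast
  }
  assume "H \<in> {?K l n | l n. arrangement_normal \<beta> l}"
  then obtain l n where H: "H = ?K l n" and l: "arrangement_normal \<beta> l" by blast
  obtain \<Gamma> where circ: "circuit b \<Gamma>" and gen: "circuit_gen \<beta> b \<Gamma> = l \<or> circuit_gen \<beta> b \<Gamma> = - l"
    by (rule arrangement_normal_imp_circuit[OF surj basis qs l])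
  \<comment> \<open>The generator is known only up to sign. Negating the equation sends
    \<open>eta / 2 + n\<close> to \<open>- eta / 2 - n\<close>, which is again of the form
    \<open>eta / 2\<close> plus an integer because \<open>eta\<close> equals the integer
    \<open>neg_sum\<close>.\<close>
  have "?K l n = ?K (- l) (- n - int (neg_sum \<beta> l))"
  proof (intro Collect_cong)
    fix y :: "complex ^ 'r"
    have "pairing (- l) y = of_real (eta \<beta> (- l) / 2 + of_int (- n - int (neg_sum \<beta> l))) +
          \<i> * of_real (pairing (- l) (shift_vec \<beta>)) \<longleftrightarrow>
        - pairing l y = - (of_real (eta \<beta> l / 2 + of_int n) + \<i> * of_real (pairing l (shift_vec \<beta>)))"
      unfolding eta_uminus[OF qs] pairing_uminus_left by (auto simp: eta_eq field_simps)
    then show "pairing l y = of_real (eta \<beta> l / 2 + of_int n) + \<i> * of_real (pairing l (shift_vec \<beta>)) \<longleftrightarrow>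
        pairing (- l) y = of_real (eta \<beta> (- l) / 2 + of_int (- n - int (neg_sum \<beta> l))) +
          \<i> * of_real (pairing (- l) (shift_vec \<beta>))"
      unfolding neg_equal_iff_equal by blast
  qed
  then obtain n' where n': "H = ?K (circuit_gen \<beta> b \<Gamma>) n'"
    using gen H by metis
  obtain m where "\<And>n. disc_hyperplane \<beta> b \<Gamma> n = ?K (circuit_gen \<beta> b \<Gamma>) (m + n)"
    using disc[of \<Gamma>] by blast
  from this[of "n' - m"] have "H = disc_hyperplane \<beta> b \<Gamma> (n' - m)"
    by (simp add: n')
  then show "H \<in> H_disc \<beta> b"
    using circ unfolding H_disc_def by blast
qed

theorem proposition4p1:
  fixes \<beta> :: "'n::finite \<Rightarrow> int ^ 'r::finite"
    and b :: "'d::finite \<Rightarrow> int ^ 'n"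
  assumes surj: "surj (weight_map \<beta>)"
    and basis: "int_basis b (relation_lattice \<beta>)"
    and distinct_rays: "inj (ray b)"
    and quasi_symmetric: "quasi_symmetric \<beta>"
  shows "H_disc \<beta> b = (\<lambda>H. (\<lambda>y. y + imag_vec (shift_vec \<beta>)) ` H) ` H_HLS \<beta>"
proof -
  have translate: "(\<lambda>y. y + imag_vec (shift_vec \<beta>)) ` {y. pairing l y = c} =
      {y. pairing l y = c + \<i> * of_real (pairing l (shift_vec \<beta>))}" for l c
    by (simp add: translate_hyperplane pairing_imag_vec)
  show ?thesis
    unfolding H_disc_eq[OF surj basis quasi_symmetric] H_HLS_eq[OF surj quasi_symmetric]
      translate[symmetric]
    by (auto simp: image_def)
qed

end
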